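(* Let $\Omega$ be a convex future complete domain in $\mathbf{R}^{1,n}$ containing no lightlike line. Then $(\Omega,\delta_\Omega)$ is Gromov hyperbolic if and only if $\partial\Omega$ is stably acausal.
   Context: Minkowski space: $\mathbf{R}^{1,n}$ ($n\ge 1$) is $\mathbf{R}\times\mathbf{R}^n$ with coordinates $(t,p)$, flat metric $\mathbf{b}=-dt^2+dp_1^2+\dots+dp_n^2$ and time orientation $\partial_t$. A nonzero vector $v$ is lightlike if $\mathbf{b}(v,v)=0$, causal if $\mathbf{b}(v,v)\le 0$, and a causal vector is future if $\mathbf{b}(v,\partial_t)<0$; a future causal curve is a piecewise smooth curve with future causal velocity. A domain is a nonempty, connected, proper open subset of $\mathbf{R}^{1,n}$. A domain $\Omega$ is future complete if every future causal curve of $\mathbf{R}^{1,n}$ starting in $\Omega$ is contained in $\Omega$. A lightlike line is a complete affine line with lightlike direction. Markowitz pseudodistance: let $I=(-1,1)$ and $\rho_I(s,t)=\left|\ln\frac{(s-1)(t+1)}{(s+1)(t-1)}\right|$. For a domain $\Omega$, a projectively parametrized lightlike geodesic of $\Omega$ is a curve $\gamma:I\to\Omega$, $\gamma(s)=x+h(s)v$, with $v$ lightlike and $h$ a (nonconstant) real homography without pole in $I$. Then $\delta_\Omega(x,y)=\inf\sum_{k=1}^m\rho_I(s_k,t_k)$, the infimum being over all finite families of such geodesics $\gamma_1,\dots,\gamma_m$ and points $s_k,t_k\in I$ with $\gamma_1(s_1)=x$, $\gamma_m(t_m)=y$, $\gamma_k(t_k)=\gamma_{k+1}(s_{k+1})$.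 Stable acausality: for $\varepsilon>0$ let $\mathbf{b}_\varepsilon=-(1+\varepsilon)^2dt^2+dp_1^2+\dots+dp_n^2$. A subset of $\mathbf{R}^{1,n}$ is $\varepsilon$-stably acausal if no two distinct points of it are causally related for $\mathbf{b}_\varepsilon$; it is stably acausal if it is $\varepsilon$-stably acausal for some $\varepsilon>0$. Gromov hyperbolicity of a proper geodesic metric space means that there is a constant $r>0$ such that each side of every geodesic triangle lies in the $r$-neighborhood of the union of the other two sides. *)

theory Defs
  imports "HOL-Analysis.Analysis"
begin

type_synonym 'n minkowski = "real \<times> (real, 'n) vec"

text \<open>The form \<open>- (1 + \<epsilon>)\<^sup>2 dt\<^sup>2 + dp\<^sub>1\<^sup>2 + \<dots> + dp\<^sub>n\<^sup>2\<close>; the flat Minkowski metric is the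
  case \<open>\<epsilon> = 0\<close>. The causality notions below take the form as a parameter, so that they can be
  used for both.\<close>

definition mink_eps :: "real \<Rightarrow> 'n::finite minkowski \<Rightarrow> 'n minkowski \<Rightarrow> real" where
  "mink_eps \<epsilon> v w = - (1 + \<epsilon>)\<^sup>2 * (fst v * fst w) + snd v \<bullet> snd w"

abbreviation mink :: "'n::finite minkowski \<Rightarrow> 'n minkowski \<Rightarrow> real" where
  "mink \<equiv> mink_eps 0"

definition lightlike :: "'n::finite minkowski \<Rightarrow> bool" where
  "lightlike v \<longleftrightarrow> v \<noteq> 0 \<and> mink v v = 0"

definition causal :: "('n::finite minkowski \<Rightarrow> 'n minkowski \<Rightarrow> real) \<Rightarrow> 'n minkowski \<Rightarrow> bool" where
  "causal B v \<longleftrightarrow> v \<noteq> 0 \<and> B v v \<le> 0"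

definition future_causal ::
  "('n::finite minkowski \<Rightarrow> 'n minkowski \<Rightarrow> real) \<Rightarrow> 'n minkowski \<Rightarrow> bool" where
  "future_causal B v \<longleftrightarrow> causal B v \<and> B v (1, 0) < 0"

text \<open>\<open>D k\<close> is the \<open>k\<close>-th derivative of the curve on \<open>[a, b]\<close>, one-sided at the endpoints, so
  that the curve is \<open>C\<^sup>\<infinity>\<close> up to the boundary and \<open>D 1\<close> is its velocity.\<close>

definition smooth_future_causal_on ::
  "('n::finite minkowski \<Rightarrow> 'n minkowski \<Rightarrow> real) \<Rightarrow> real \<Rightarrow> real \<Rightarrow> (real \<Rightarrow> 'n minkowski) \<Rightarrow> bool" where
  "smooth_future_causal_on B a b c \<longleftrightarrow>
     (\<exists>D :: nat \<Rightarrow> real \<Rightarrow> 'n minkowski.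
        (\<forall>t\<in>{a..b}. D 0 t = c t) \<and>
        (\<forall>k. \<forall>t\<in>{a..b}. (D k has_vector_derivative D (Suc k) t) (at t within {a..b})) \<and>
        (\<forall>t\<in>{a..b}. future_causal B (D 1 t)))"

text \<open>Continuity at the break points \<open>\<tau> i\<close> is automatic because the closed pieces share them.\<close>

definition future_causal_curve ::
  "('n::finite minkowski \<Rightarrow> 'n minkowski \<Rightarrow> real) \<Rightarrow> real \<Rightarrow> real \<Rightarrow> (real \<Rightarrow> 'n minkowski) \<Rightarrow> bool" where
  "future_causal_curve B a b c \<longleftrightarrow>
     a < b \<and>
     (\<exists>(m::nat) (\<tau>::nat \<Rightarrow> real). \<tau> 0 = a \<and> \<tau> m = b \<and>
        (\<forall>i<m. \<tau> i < \<tau> (Suc i) \<and> smooth_future_causal_on B (\<tau> i) (\<tau> (Suc i)) c))"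

definition causally_related ::
  "('n::finite minkowski \<Rightarrow> 'n minkowski \<Rightarrow> real) \<Rightarrow> 'n minkowski \<Rightarrow> 'n minkowski \<Rightarrow> bool" where
  "causally_related B x y \<longleftrightarrow>
     (\<exists>a b c. future_causal_curve B a b c \<and> (c a = x \<and> c b = y \<or> c a = y \<and> c b = x))"

definition eps_stably_acausal :: "real \<Rightarrow> 'n::finite minkowski set \<Rightarrow> bool" where
  "eps_stably_acausal \<epsilon> A \<longleftrightarrow>
     (\<forall>x\<in>A. \<forall>y\<in>A. x \<noteq> y \<longrightarrow> \<not> causally_related (mink_eps \<epsilon>) x y)"

definition stably_acausal :: "'n::finite minkowski set \<Rightarrow> bool" where
  "stably_acausal A \<longleftrightarrow> (\<exists>\<epsilon>>0. eps_stably_acausal \<epsilon> A)"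

definition mink_domain :: "'n::finite minkowski set \<Rightarrow> bool" where
  "mink_domain \<Omega> \<longleftrightarrow> open \<Omega> \<and> connected \<Omega> \<and> \<Omega> \<noteq> {} \<and> \<Omega> \<noteq> UNIV"

definition future_complete :: "'n::finite minkowski set \<Rightarrow> bool" where
  "future_complete \<Omega> \<longleftrightarrow>
     (\<forall>a b c. future_causal_curve mink a b c \<and> c a \<in> \<Omega> \<longrightarrow> c ` {a..b} \<subseteq> \<Omega>)"

definition lightlike_line :: "'n::finite minkowski set \<Rightarrow> bool" where
  "lightlike_line L \<longleftrightarrow> (\<exists>x v. lightlike v \<and> L = range (\<lambda>s::real. x + s *\<^sub>R v))"

definition rho :: "real \<Rightarrow> real \<Rightarrow> real" where
  "rho s t = \<bar>ln (((s - 1) * (t + 1)) / ((s + 1) * (t - 1)))\<bar>"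

definition proj_lightlike_geodesic ::
  "'n::finite minkowski set \<Rightarrow> (real \<Rightarrow> 'n minkowski) \<Rightarrow> bool" where
  "proj_lightlike_geodesic \<Omega> \<gamma> \<longleftrightarrow>
     (\<exists>x v (a::real) b c d. lightlike v \<and> a * d - b * c \<noteq> 0 \<and>
        (\<forall>s\<in>{-1<..<1}. c * s + d \<noteq> 0 \<and> \<gamma> s = x + ((a * s + b) / (c * s + d)) *\<^sub>R v \<and> \<gamma> s \<in> \<Omega>))"

definition chain_lengths ::
  "'n::finite minkowski set \<Rightarrow> 'n minkowski \<Rightarrow> 'n minkowski \<Rightarrow> real set" where
  "chain_lengths \<Omega> x y =
     {(\<Sum>k=1..m. rho (s k) (t k)) | (m::nat) s t. \<exists>\<gamma>.
        1 \<le> m \<and>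
        (\<forall>k\<in>{1..m}. proj_lightlike_geodesic \<Omega> (\<gamma> k) \<and> s k \<in> {-1<..<1} \<and> t k \<in> {-1<..<1}) \<and>
        \<gamma> 1 (s 1) = x \<and> \<gamma> m (t m) = y \<and>
        (\<forall>k\<in>{1..<m}. \<gamma> k (t k) = \<gamma> (Suc k) (s (Suc k)))}"

text \<open>Any two points of a domain are joined by a chain, because the lightlike vectors span the
  space and a domain is connected. The value 0 is thus only taken as a dummy outside the domain,
  where the infimum of the empty set of reals would be unspecified.\<close>

definition markowitz_dist ::
  "'n::finite minkowski set \<Rightarrow> 'n minkowski \<Rightarrow> 'n minkowski \<Rightarrow> real" where
  "markowitz_dist \<Omega> x y = (if chain_lengths \<Omega> x y = {} then 0 else Inf (chain_lengths \<Omega> x y))"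

definition proper_metric_space :: "'a set \<Rightarrow> ('a \<Rightarrow> 'a \<Rightarrow> real) \<Rightarrow> bool" where
  "proper_metric_space M d \<longleftrightarrow> Metric_space M d \<and>
     (\<forall>x\<in>M. \<forall>r. compactin (Metric_space.mtopology M d) (Metric_space.mcball M d x r))"

definition geodesic_segment ::
  "'a set \<Rightarrow> ('a \<Rightarrow> 'a \<Rightarrow> real) \<Rightarrow> 'a \<Rightarrow> 'a \<Rightarrow> 'a set \<Rightarrow> bool" where
  "geodesic_segment M d x y S \<longleftrightarrow>
     (\<exists>(l::real) c. 0 \<le> l \<and> c ` {0..l} = S \<and> S \<subseteq> M \<and> c 0 = x \<and> c l = y \<and>
        (\<forall>s\<in>{0..l}. \<forall>t\<in>{0..l}. d (c s) (c t) = \<bar>s - t\<bar>))"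

definition geodesic_metric_space :: "'a set \<Rightarrow> ('a \<Rightarrow> 'a \<Rightarrow> real) \<Rightarrow> bool" where
  "geodesic_metric_space M d \<longleftrightarrow> Metric_space M d \<and>
     (\<forall>x\<in>M. \<forall>y\<in>M. \<exists>S. geodesic_segment M d x y S)"

definition nbhd :: "'a set \<Rightarrow> ('a \<Rightarrow> 'a \<Rightarrow> real) \<Rightarrow> real \<Rightarrow> 'a set \<Rightarrow> 'a set" where
  "nbhd M d r A = {p \<in> M. \<exists>q\<in>A. d p q < r}"

definition gromov_hyperbolic :: "'a set \<Rightarrow> ('a \<Rightarrow> 'a \<Rightarrow> real) \<Rightarrow> bool" where
  "gromov_hyperbolic M d \<longleftrightarrow>
     proper_metric_space M d \<and> geodesic_metric_space M d \<and>
     (\<exists>r>0. \<forall>x\<in>M. \<forall>y\<in>M. \<forall>z\<in>M. \<forall>S T U.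
        geodesic_segment M d x y S \<and> geodesic_segment M d y z T \<and> geodesic_segment M d z x U \<longrightarrow>
          S \<subseteq> nbhd M d r (T \<union> U) \<and> T \<subseteq> nbhd M d r (U \<union> S) \<and> U \<subseteq> nbhd M d r (S \<union> T))"

end

theory Submission
  imports Defs
begin

text \<open>Future completeness and convexity make \<open>\<Omega>\<close> the strict epigraph \<open>{(t, p). f p < t}\<close> of a convex
  1-Lipschitz function \<open>f\<close>, and its boundary is stably acausal iff \<open>f\<close> is \<open>L\<close>-Lipschitz for some \<open>L < 1\<close>.
  The distance \<open>\<delta>\<close> is controlled from above by lightlike half-lines in \<open>\<Omega>\<close> and from below by supporting
  half-spaces: if an affine functional \<open>\<phi>\<close> is positive on \<open>\<Omega>\<close>, then \<open>ln \<phi>\<close> is 1-Lipschitz for \<open>\<delta>\<close>.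

  If \<open>L < 1\<close>, then with \<open>h x = fst x - f (snd x)\<close> these bounds give, up to an additive constant,
  \<open>\<delta> x y = 2 ln (norm (snd x - snd y) + h x + h y) - ln (h x) - ln (h y)\<close>. The first logarithm is that of a
  quasi-metric, for which a Ptolemy-like inequality is immediate; it is the four point condition for
  \<open>\<delta>\<close>. No stability of quasi-geodesics is needed.

  If no \<open>L < 1\<close> works, then \<open>f\<close> has asymptotic slope 1 in some direction \<open>u\<close>. The plane spanned by
  \<open>u\<close> and the time axis contains a quadrant in null coordinates \<open>U, V > 0\<close>. Because \<open>\<Omega>\<close> contains no
  lightlike line, there are supporting half-spaces which bound \<open>\<delta>\<close> from below by the variation of
  \<open>ln U\<close> and of \<open>ln V\<close>, far out in the quadrant. Hence a point of a null geodesic can be avoided at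
  distance \<open>R\<close> by a detour of length \<open>4 R\<close>, whereas in a hyperbolic space a detour at distance \<open>R\<close> has
  length exponential in \<open>R\<close>.\<close>

section \<open>Geodesic metric spaces\<close>

lemma geodesic_segment_sym:
  assumes "geodesic_segment M d x y S"
  shows "geodesic_segment M d y x S"
proof -
  obtain l c where c: "0 \<le> l" "c ` {0..l} = S" "S \<subseteq> M" "c 0 = x" "c l = y"
    "\<forall>s\<in>{0..l}. \<forall>t\<in>{0..l}. d (c s) (c t) = \<bar>s - t\<bar>"
    using assms unfolding geodesic_segment_def by blast
  have im: "(\<lambda>s. l - s) ` {0..l} = {0..l}"
    using c(1) by (auto simp: image_iff intro: bexI[where x = "l - _"])
  show ?thesis
    unfolding geodesic_segment_def
  proof (intro exI conjI)
    show "(\<lambda>s. c (l - s)) ` {0..l} = S"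
      using c(2) im by (metis image_image)
  qed (use c in auto)
qed

lemma geodesic_segment_mem:
  assumes "geodesic_segment M d x y S" "p \<in> S"
  shows "p \<in> M" "d x p + d p y = d x y"
proof -
  obtain l c where c: "0 \<le> l" "c ` {0..l} = S" "S \<subseteq> M" "c 0 = x" "c l = y"
    "\<forall>s\<in>{0..l}. \<forall>t\<in>{0..l}. d (c s) (c t) = \<bar>s - t\<bar>"
    using assms unfolding geodesic_segment_def by blast
  show "p \<in> M" using c assms by auto
  obtain s where s: "s \<in> {0..l}" "p = c s" using c assms by blast
  have "d (c 0) (c s) = s" "d (c s) (c l) = l - s" "d (c 0) (c l) = l"
    using c(1) s(1) c(6) by auto
  then show "d x p + d p y = d x y" using c s by auto
qed

lemma geodesic_segment_point:
  assumes "geodesic_segment M d x y S" "0 \<le> a" "a \<le> d x y"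
  obtains q where "q \<in> S" "d x q = a" "d q y = d x y - a"
proof -
  obtain l c where c: "0 \<le> l" "c ` {0..l} = S" "S \<subseteq> M" "c 0 = x" "c l = y"
    "\<forall>s\<in>{0..l}. \<forall>t\<in>{0..l}. d (c s) (c t) = \<bar>s - t\<bar>"
    using assms unfolding geodesic_segment_def by blast
  have l: "d x y = l" using c(1,6) c(4,5)[symmetric] by simp
  have "d (c 0) (c a) = a" "d (c a) (c l) = l - a"
    using c(1,6) assms l by auto
  with that[of "c a"] c l assms show ?thesis by auto
qed

lemma geodesic_segment_ends:
  assumes "geodesic_segment M d x y S"
  shows "x \<in> S" "y \<in> S" "x \<in> M" "y \<in> M"
proof -
  obtain l c where c: "(0::real) \<le> l" "c ` {0..l} = S" "S \<subseteq> M" "c 0 = x" "c l = y"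
    using assms unfolding geodesic_segment_def by blast
  have "c 0 \<in> S" "c l \<in> S" using c(1,2) by auto
  then show "x \<in> S" "y \<in> S" "x \<in> M" "y \<in> M" using c by auto
qed

context Metric_space
begin

text \<open>For \<open>p\<close> on the side from \<open>x\<close> to \<open>y\<close>,
  \<open>d x y\<close> splits as \<open>d x p + d p y\<close>, so the four point condition for
  \<open>x y z p\<close> says that \<open>p\<close> is almost between the endpoints of one of the
  other two sides. Such a point is close to that side.\<close>

lemma four_point_imp_thin:
  assumes fp: "\<And>x y z w. \<lbrakk>x \<in> M; y \<in> M; z \<in> M; w \<in> M\<rbrakk> \<Longrightarrow>
      d x y + d z w \<le> max (d x z + d y w) (d x w + d y z) + C"
    and S: "geodesic_segment M d x y S" and T: "geodesic_segment M d y z T"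
    and U: "geodesic_segment M d z x U" and p: "p \<in> S"
  shows "\<exists>q\<in>T \<union> U. d p q \<le> 2 * C"
proof -
  note M = geodesic_segment_ends[OF S] geodesic_segment_ends[OF T] geodesic_segment_ends[OF U]
  note pM = geodesic_segment_mem[OF S p]
  have C: "0 \<le> C" using fp[of x x x x] M by simp
  \<comment> \<open>The witness is the point of \<open>V\<close> as far from \<open>a\<close> as
    \<open>p\<close> is, or the endpoint \<open>z\<close> if \<open>V\<close> is too short. One
    error \<open>C\<close> comes from \<open>le\<close>, the other from the four point condition for
    \<open>p q a z\<close>.\<close>
  have *: "\<exists>q\<in>V. d p q \<le> 2 * C"
    if le: "d a p + d p z \<le> d a z + C" and V: "geodesic_segment M d a z V" for a V
  proof -
    note Vm = geodesic_segment_ends[OF V]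
    show ?thesis
    proof (cases "d a p \<le> d a z")
      case True
      obtain q where q: "q \<in> V" "d a q = d a p" "d q z = d a z - d a p"
        using geodesic_segment_point[OF V _ True] by auto
      have qM: "q \<in> M" using geodesic_segment_mem[OF V q(1)] by auto
      have "d p q + d a z \<le> max (d p a + d q z) (d p z + d q a) + C"
        by (rule fp) (use pM qM Vm in auto)
      then have "d p q \<le> 2 * C" using q le C by (auto simp: commute)
      then show ?thesis using q by blast
    next
      case False
      then have "d p z \<le> C" using le by linarith
      then show ?thesis using Vm C by force
    qed
  qed
  have "d x y + d z p \<le> max (d x z + d y p) (d x p + d y z) + C"
    by (rule fp) (use M pM in auto)
  then have "d x p + d p z \<le> d x z + C \<or> d y p + d p z \<le> d y z + C"
    using pM by (auto simp: commute)
  then show ?thesis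
    using *[OF _ T] *[OF _ geodesic_segment_sym[OF U]] by blast
qed

text \<open>Iterated bisection: a geodesic is logarithmically close, in the number of steps, to any chain
  with the same endpoints.\<close>

lemma thin_triangles_log_chain:
  assumes geo: "geodesic_metric_space M d"
    and thin: "\<And>x y z S T U p. \<lbrakk>geodesic_segment M d x y S; geodesic_segment M d y z T;
        geodesic_segment M d z x U; p \<in> S\<rbrakk> \<Longrightarrow> \<exists>q\<in>T \<union> U. d p q \<le> r"
    and "\<And>i. i \<le> 2 ^ k \<Longrightarrow> c i \<in> M" and "\<And>i. i < 2 ^ k \<Longrightarrow> d (c i) (c (Suc i)) \<le> D"
    and "geodesic_segment M d (c 0) (c (2 ^ k)) S" and "p \<in> S"
  shows "\<exists>i\<le>2 ^ k. d p (c i) \<le> r * real k + D"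
  using assms(3-)
proof (induction k arbitrary: c S p)
  case 0
  note p = geodesic_segment_mem[OF "0.prems"(3,4)]
  have "d (c 0) p + d p (c (Suc 0)) \<le> D" using p(2) "0.prems"(2)[of 0] by simp
  then have "d (c 0) p \<le> D" using nonneg[of p "c (Suc 0)"] by linarith
  then show ?case by (intro exI[of _ 0]) (simp add: commute)
next
  case (Suc k)
  \<comment> \<open>The triangle with vertices \<open>c 0\<close>, \<open>c ?m\<close>,
    \<open>c (2 * ?m)\<close> moves \<open>p\<close> by at most \<open>r\<close> to a side spanned
    by one half of the chain, so each halving costs \<open>r\<close>.\<close>
  let ?m = "2 ^ k :: nat"
  have M: "c 0 \<in> M" "c ?m \<in> M" "c (2 * ?m) \<in> M" using Suc.prems(1) by auto
  obtain T U where T: "geodesic_segment M d (c ?m) (c (2 * ?m)) T"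
    and U: "geodesic_segment M d (c 0) (c ?m) U"
    using geo M unfolding geodesic_metric_space_def by blast
  have S: "geodesic_segment M d (c 0) (c (2 * ?m)) S" using Suc.prems(3) by simp
  obtain q where q: "q \<in> T \<union> U" "d p q \<le> r"
    using thin[OF S geodesic_segment_sym[OF T] geodesic_segment_sym[OF U] Suc.prems(4)] by auto
  have qM: "q \<in> M" using q(1) geodesic_segment_mem(1)[OF T] geodesic_segment_mem(1)[OF U] by blast
  have pM: "p \<in> M" by (rule geodesic_segment_mem(1)[OF S Suc.prems(4)])
  have "\<exists>i\<le>2 ^ Suc k. d q (c i) \<le> r * real k + D"
  proof (cases "q \<in> U")
    case True
    have "\<exists>i\<le>2 ^ k. d q (c i) \<le> r * real k + D"
    proof (rule Suc.IH[OF _ _ U True])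
      fix i :: nat
      show "c i \<in> M" if "i \<le> 2 ^ k" using that by (intro Suc.prems(1)) simp
      show "d (c i) (c (Suc i)) \<le> D" if "i < 2 ^ k" using that by (intro Suc.prems(2)) simp
    qed
    then obtain i where "i \<le> 2 ^ k" "d q (c i) \<le> r * real k + D" by blast
    then show ?thesis by (intro exI[of _ i]) auto
  next
    case False
    then have "q \<in> T" using q by auto
    then have "\<exists>i\<le>2 ^ k. d q (c (i + ?m)) \<le> r * real k + D"
    proof (intro Suc.IH[of "\<lambda>i. c (i + ?m)" T q])
      fix i :: nat
      show "c (i + ?m) \<in> M" if "i \<le> 2 ^ k" using that by (intro Suc.prems(1)) simp
      have "d (c (i + ?m)) (c (Suc (i + ?m))) \<le> D" if "i < 2 ^ k"
        using that by (intro Suc.prems(2)) simp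
      then show "d (c (i + ?m)) (c (Suc i + ?m)) \<le> D" if "i < 2 ^ k" using that by simp
    qed (use T in \<open>simp_all add: mult_2\<close>)
    then obtain i where "i \<le> 2 ^ k" "d q (c (i + ?m)) \<le> r * real k + D" by blast
    then show ?thesis by (intro exI[of _ "i + ?m"]) auto
  qed
  then obtain i where i: "i \<le> 2 ^ Suc k" "d q (c i) \<le> r * real k + D" by blast
  have "d p (c i) \<le> d p q + d q (c i)" using pM qM Suc.prems(1)[OF i(1)] by (rule triangle)
  then have "d p (c i) \<le> r * real (Suc k) + D" using q i by (simp add: algebra_simps)
  then show ?case using i by blast
qed

end

section \<open>Geodesics from midpoints by dyadic subdivision\<close>

text \<open>For a midpoint map \<open>m\<close> and \<open>i \<le> 2 ^ n\<close> this is the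
  candidate for the point at parameter \<open>i / 2 ^ n\<close> of a geodesic from \<open>x\<close>
  to \<open>y\<close>. Even indices repeat the previous level, so that the levels refine each
  other.\<close>

primrec dyadic_pt :: "('a \<Rightarrow> 'a \<Rightarrow> 'a) \<Rightarrow> 'a \<Rightarrow> 'a \<Rightarrow> nat \<Rightarrow> nat \<Rightarrow> 'a" where
  "dyadic_pt m x y 0 i = (if i = 0 then x else y)"
| "dyadic_pt m x y (Suc n) i = (if even i then dyadic_pt m x y n (i div 2)
     else m (dyadic_pt m x y n (i div 2)) (dyadic_pt m x y n (Suc (i div 2))))"

context Metric_space
begin

context
  fixes m x y L
  assumes xy: "x \<in> M" "y \<in> M" and L: "L = d x y"
    and mid: "\<And>u v. \<lbrakk>u \<in> M; v \<in> M\<rbrakk> \<Longrightarrow> m u v \<in> M \<and> d u (m u v) = d u v / 2 \<and> d (m u v) v = d u v / 2"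
begin

lemma dyadic_pt_in: "i \<le> 2 ^ n \<Longrightarrow> dyadic_pt m x y n i \<in> M"
proof (induction n arbitrary: i)
  case (Suc n)
  have "i div 2 \<le> 2 ^ n" using Suc.prems by auto
  moreover have "Suc (i div 2) \<le> 2 ^ n" if "odd i"
    using Suc.prems that by (auto elim!: oddE)
  ultimately show ?case using Suc.IH mid by auto
qed (use xy in auto)

lemma dyadic_pt_step: "i < 2 ^ n \<Longrightarrow> d (dyadic_pt m x y n i) (dyadic_pt m x y n (Suc i)) = L / 2 ^ n"
proof (induction n arbitrary: i)
  case 0
  then show ?case using L by simp
next
  case (Suc n)
  have i: "i div 2 < 2 ^ n" using Suc.prems by auto
  then have M: "dyadic_pt m x y n (i div 2) \<in> M" "dyadic_pt m x y n (Suc (i div 2)) \<in> M"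
    using dyadic_pt_in by (auto intro: dyadic_pt_in)
  show ?case using Suc.IH[OF i] mid[OF M] by (cases "even i") auto
qed

lemma dyadic_pt_dist:
  "i + j \<le> 2 ^ n \<Longrightarrow> d (dyadic_pt m x y n i) (dyadic_pt m x y n (i + j)) \<le> real j * (L / 2 ^ n)"
proof (induction j)
  case 0
  then show ?case using dyadic_pt_in by simp
next
  case (Suc j)
  have "d (dyadic_pt m x y n i) (dyadic_pt m x y n (i + Suc j))
      \<le> d (dyadic_pt m x y n i) (dyadic_pt m x y n (i + j))
        + d (dyadic_pt m x y n (i + j)) (dyadic_pt m x y n (Suc (i + j)))"
    unfolding add_Suc_right by (rule triangle; rule dyadic_pt_in) (use Suc.prems in auto)
  then show ?case using Suc dyadic_pt_step[of "i + j" n] by (simp add: algebra_simps add_divide_distrib)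
qed

lemma dyadic_pt_refine:
  assumes "i \<le> 2 ^ n" "j \<le> 2 ^ Suc n" "j div 2 = i"
  shows "d (dyadic_pt m x y n i) (dyadic_pt m x y (Suc n) j) \<le> L / 2 ^ Suc n"
proof (cases "even j")
  case True
  then show ?thesis using dyadic_pt_in[OF assms(1)] assms(3) L by simp
next
  case False
  then have i: "i < 2 ^ n" using assms by (auto elim!: oddE)
  then have "dyadic_pt m x y n i \<in> M" "dyadic_pt m x y n (Suc i) \<in> M"
    by (auto intro!: dyadic_pt_in)
  from mid[OF this] have "d (dyadic_pt m x y n i) (m (dyadic_pt m x y n i) (dyadic_pt m x y n (Suc i)))
      = L / 2 ^ n / 2"
    by (simp only: dyadic_pt_step[OF i])
  then show ?thesis using False assms(3) by simp
qed

end

text \<open>The dyadic points define step functions \<open>g n\<close> on the unit interval,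
  Lipschitz up to an error \<open>L / 2 ^ n\<close> and uniformly Cauchy. Compact balls supply the
  limit \<open>c\<close>, which is \<open>L\<close>-Lipschitz between points at distance
  \<open>L\<close> and hence has constant speed.\<close>

lemma midpoints_imp_geodesic:
  assumes proper: "\<And>x r. x \<in> M \<Longrightarrow> compactin mtopology (mcball x r)"
    and midpt: "\<And>x y. \<lbrakk>x \<in> M; y \<in> M\<rbrakk> \<Longrightarrow> \<exists>z\<in>M. d x z = d x y / 2 \<and> d z y = d x y / 2"
    and xy: "x \<in> M" "y \<in> M"
  shows "\<exists>S. geodesic_segment M d x y S"
proof (cases "x = y")
  case True
  have "geodesic_segment M d x y {x}"
    unfolding geodesic_segment_def
    by (rule exI[of _ 0], rule exI[of _ "\<lambda>_. x"]) (use xy True in auto)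
  then show ?thesis by blast
next
  case False
  define L where "L = d x y"
  have Lpos: "0 < L" using False xy L_def by simp
  have pow: "0 \<le> L / 2 ^ n" for n :: nat using Lpos by simp
  obtain m where mid: "\<And>u v. \<lbrakk>u \<in> M; v \<in> M\<rbrakk> \<Longrightarrow>
      m u v \<in> M \<and> d u (m u v) = d u v / 2 \<and> d (m u v) v = d u v / 2"
    using midpt by metis
  \<comment> \<open>The index of the last dyadic parameter of level \<open>n\<close> not exceeding
    \<open>t\<close>. By \<open>k_div\<close> the indices of successive levels are related by
    halving, as \<open>dyadic_pt_refine\<close> requires.\<close>
  define k :: "nat \<Rightarrow> real \<Rightarrow> nat" where "k n t = nat \<lfloor>t * 2 ^ n\<rfloor>" for n t
  define g where "g n t = dyadic_pt m x y n (k n t)" for n t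
  have k_le: "k n t \<le> 2 ^ n" if "t \<in> {0..1}" for n t
  proof -
    have "t * 2 ^ n \<le> 2 ^ n" using that by (simp add: mult_left_le_one_le)
    then have "t * 2 ^ n < 2 ^ n + 1" by linarith
    then have "\<lfloor>t * 2 ^ n\<rfloor> \<le> 2 ^ n" by (simp add: floor_le_iff)
    then show ?thesis unfolding k_def by (simp add: nat_le_iff)
  qed
  have k_div: "k (Suc n) t div 2 = k n t" if "t \<in> {0..1}" for n t
  proof -
    have "nat \<lfloor>2 * s\<rfloor> div 2 = nat \<lfloor>s\<rfloor>" if "0 \<le> s" for s :: real
    proof -
      have "\<lfloor>2 * s\<rfloor> div 2 = \<lfloor>s\<rfloor>"
        using floor_divide_real_eq_div[of 2 "2 * s"] by simp
      then show ?thesis using nat_div_distrib[of "\<lfloor>2 * s\<rfloor>" 2] that by simp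
    qed
    from this[of "t * 2 ^ n"] that show ?thesis unfolding k_def by (simp add: ac_simps)
  qed
  have gM: "g n t \<in> M" if "t \<in> {0..1}" for n t
    unfolding g_def using dyadic_pt_in[OF xy L_def mid k_le[OF that]] by blast
  have refine: "d (g n t) (g (Suc n) t) \<le> L / 2 ^ Suc n" if "t \<in> {0..1}" for n t
    unfolding g_def
    using dyadic_pt_refine[OF xy L_def mid k_le[OF that] k_le[OF that] k_div[OF that]] by blast
  \<comment> \<open>The right-hand side is the exact geometric sum of the bounds
    \<open>refine\<close>, which makes the induction close.\<close>
  have cauchy: "d (g n t) (g (n + j) t) \<le> L / 2 ^ n - L / 2 ^ (n + j)" if "t \<in> {0..1}" for n j t
  proof (induction j)
    case 0
    then show ?case using gM[OF that] by simp
  next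
    case (Suc j)
    have "d (g n t) (g (n + Suc j) t) \<le> d (g n t) (g (n + j) t) + d (g (n + j) t) (g (Suc (n + j)) t)"
      unfolding add_Suc_right using gM[OF that] by (intro triangle)
    then show ?case using Suc refine[OF that, of "n + j"] by simp
  qed
  have lip: "d (g n s) (g n t) \<le> L / 2 ^ n + (t - s) * L"
    if "s \<in> {0..1}" "t \<in> {0..1}" "s \<le> t" for n s t
  proof -
    have le: "\<lfloor>s * 2 ^ n\<rfloor> \<le> \<lfloor>t * 2 ^ n\<rfloor>" "0 \<le> \<lfloor>s * 2 ^ n\<rfloor>"
      using that by (auto intro!: floor_mono)
    then have "k n s \<le> k n t" unfolding k_def by auto
    then obtain j where j: "k n t = k n s + j" by (auto simp: le_iff_add)
    have "real j = real_of_int \<lfloor>t * 2 ^ n\<rfloor> - real_of_int \<lfloor>s * 2 ^ n\<rfloor>"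
      using j le unfolding k_def by linarith
    also have "\<dots> \<le> t * 2 ^ n - (s * 2 ^ n - 1)" by linarith
    finally have rj: "real j \<le> 1 + (t - s) * 2 ^ n" by (simp add: algebra_simps)
    have "d (g n s) (g n t) \<le> real j * (L / 2 ^ n)"
      using dyadic_pt_dist[OF xy L_def mid, of "k n s" j n] k_le[OF that(2), of n] unfolding g_def j by auto
    also have "\<dots> \<le> (1 + (t - s) * 2 ^ n) * (L / 2 ^ n)"
      using rj Lpos by (intro mult_right_mono) auto
    finally show ?thesis by (simp add: field_simps)
  qed
  \<comment> \<open>Compactness gives the limit of a subsequence only; \<open>cauchy\<close> turns
    it into a bound for every \<open>n\<close>.\<close>
  have ex: "\<exists>l\<in>M. \<forall>n. d (g n t) l \<le> L / 2 ^ n" if t: "t \<in> {0..1}" for t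
  proof -
    have "d (g 0 t) (g n t) \<le> L" for n
      using cauchy[OF t, of 0 n] pow[of n] by simp
    then have "range (\<lambda>n. g n t) \<subseteq> mcball (g 0 t) L" using gM[OF t] by auto
    then obtain l r where l: "l \<in> mcball (g 0 t) L" "strict_mono r"
        "limitin mtopology ((\<lambda>n. g n t) \<circ> r) l sequentially"
      using proper[OF gM[OF t]] unfolding compactin_sequentially by meson
    have lM: "l \<in> M" using l(1) by auto
    have "d (g n t) l \<le> L / 2 ^ n + e" if e: "0 < e" for e n
    proof -
      obtain N where N: "\<And>i. i \<ge> N \<Longrightarrow> d (g (r i) t) l < e"
        using l(3) e unfolding limit_metric_sequentially o_def by meson
      define i where "i = max N n"
      have "n \<le> r i" using l(2) seq_suble[of r i] unfolding i_def by auto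
      then obtain j where j: "r i = n + j" by (auto simp: le_iff_add)
      have "d (g n t) l \<le> d (g n t) (g (r i) t) + d (g (r i) t) l"
        using gM[OF t] lM by (intro triangle)
      moreover have "d (g n t) (g (r i) t) \<le> L / 2 ^ n"
        using cauchy[OF t, of n j] pow[of "n + j"] unfolding j by linarith
      ultimately show ?thesis using N[of i] unfolding i_def by auto
    qed
    then have "d (g n t) l \<le> L / 2 ^ n" for n by (rule field_le_epsilon)
    then show ?thesis using lM by blast
  qed
  define c where "c t = (SOME l. l \<in> M \<and> (\<forall>n. d (g n t) l \<le> L / 2 ^ n))" for t
  have "c t \<in> M \<and> (\<forall>n. d (g n t) (c t) \<le> L / 2 ^ n)" if "t \<in> {0..1}" for t
    unfolding c_def by (rule someI_ex) (use ex[OF that] in blast)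
  then have cM: "\<And>t. t \<in> {0..1} \<Longrightarrow> c t \<in> M"
    and c: "\<And>t n. t \<in> {0..1} \<Longrightarrow> d (g n t) (c t) \<le> L / 2 ^ n" by blast+
  have lim: "(\<lambda>n. A * (L / 2 ^ n)) \<longlonglongrightarrow> 0" for A
    using tendsto_mult_right_zero[OF LIMSEQ_divide_realpow_zero[of 2 L]] by auto
  have c_lip: "d (c s) (c t) \<le> (t - s) * L" if "s \<in> {0..1}" "t \<in> {0..1}" "s \<le> t" for s t
  proof -
    have "d (c s) (c t) \<le> 3 * (L / 2 ^ n) + (t - s) * L" for n
    proof -
      have "d (c s) (c t) \<le> d (c s) (g n s) + d (g n s) (g n t) + d (g n t) (c t)"
        using triangle[OF cM[OF that(1)] gM[OF that(1)] cM[OF that(2)], of n]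
          triangle[OF gM[OF that(1)] gM[OF that(2)] cM[OF that(2)], of n n] by linarith
      then show ?thesis using c[OF that(1), of n] c[OF that(2), of n] lip[OF that, of n] by (simp add: commute)
    qed
    then have "d (c s) (c t) \<le> 0 + (t - s) * L"
      by (intro LIMSEQ_le_const[OF tendsto_add[OF lim[of 3] tendsto_const]]) blast
    then show ?thesis by simp
  qed
  have c_end: "c t = z" if "t \<in> {0..1}" "z \<in> M" "\<And>n. g n t = z" for t z
  proof -
    have "d z (c t) \<le> 1 * (L / 2 ^ n)" for n using c[OF that(1), of n] that(3) by simp
    then have "d z (c t) \<le> 0" by (intro LIMSEQ_le_const[OF lim[of 1]]) blast
    then have "d z (c t) = 0" by (simp add: order_antisym)
    then show ?thesis using zero[OF that(2) cM[OF that(1)]] by simp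
  qed
  have dy: "dyadic_pt m x y n 0 = x" "dyadic_pt m x y n (2 ^ n) = y" for n
    by (induction n) auto
  have c0: "c 0 = x" by (rule c_end) (use xy dy in \<open>auto simp: g_def k_def\<close>)
  have "k n 1 = 2 ^ n" for n
    unfolding k_def by (metis floor_of_nat mult_1 nat_int of_nat_numeral of_nat_power)
  then have c1: "c 1 = y" by (intro c_end) (use xy dy in \<open>auto simp: g_def\<close>)
  \<comment> \<open>The Lipschitz bounds on the three pieces from 0 to \<open>s\<close>, to
    \<open>t\<close> and to 1 add up to exactly \<open>L = d x y\<close>, so none of them can be
    strict.\<close>
  have c_eq: "d (c s) (c t) = (t - s) * L" if st: "s \<in> {0..1}" "t \<in> {0..1}" "s \<le> t" for s t
  proof -
    have "L \<le> d (c 0) (c s) + d (c s) (c t) + d (c t) (c 1)"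
      using triangle[OF xy(1) cM[OF st(1)] xy(2)] triangle[OF cM[OF st(1)] cM[OF st(2)] xy(2)]
      unfolding c0 c1 L_def by linarith
    also have "\<dots> \<le> s * L + d (c s) (c t) + (1 - t) * L"
      using c_lip[of 0 s] c_lip[of t 1] st by simp
    finally show ?thesis using c_lip[OF st] by (simp add: algebra_simps)
  qed
  have "geodesic_segment M d x y ((\<lambda>s. c (s / L)) ` {0..L})"
    unfolding geodesic_segment_def
  proof (intro exI conjI ballI)
    have sc: "s / L \<in> {0..1}" if "s \<in> {0..L}" for s using that Lpos by auto
    show "(\<lambda>s. c (s / L)) ` {0..L} \<subseteq> M" using cM sc by auto
    fix s t assume st: "s \<in> {0..L}" "t \<in> {0..L}"
    show "d (c (s / L)) (c (t / L)) = \<bar>s - t\<bar>"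
    proof (cases "s \<le> t")
      case True
      then have "s / L \<le> t / L" using Lpos by (simp add: divide_right_mono)
      then have "d (c (s / L)) (c (t / L)) = (t / L - s / L) * L" using c_eq sc st by blast
      then show ?thesis using Lpos True by (simp add: left_diff_distrib)
    next
      case False
      then have "t / L \<le> s / L" using Lpos by (simp add: divide_right_mono)
      then have "d (c (t / L)) (c (s / L)) = (s / L - t / L) * L" using c_eq sc st by blast
      then show ?thesis using Lpos False by (simp add: left_diff_distrib commute)
    qed
  qed (use Lpos c0 c1 in auto)
  then show ?thesis by blast
qed

end

section \<open>Chains of lightlike geodesics\<close>

text \<open>In the coordinate \<open>2 * artanh\<close> the distance \<open>rho\<close> becomes that
  of the real line, hence additive along a geodesic.\<close>

lemma rho_artanh:
  assumes "s \<in> {-1<..<1}" "t \<in> {-1<..<1}"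
  shows "rho s t = 2 * \<bar>artanh s - artanh t\<bar>"
proof -
  have e1: "((s - 1) * (t + 1)) / ((s + 1) * (t - 1)) = ((1 + t) / (1 - t)) / ((1 + s) / (1 - s))"
  proof -
    have "(s - 1) * (t + 1) = - ((1 - s) * (1 + t))" "(s + 1) * (t - 1) = - ((1 + s) * (1 - t))"
      by algebra+
    then show ?thesis by (simp only: minus_divide_divide) (simp add: ac_simps)
  qed
  have e2: "ln (((1 + t) / (1 - t)) / ((1 + s) / (1 - s)))
      = ln ((1 + t) / (1 - t)) - ln ((1 + s) / (1 - s))"
    using assms by (subst ln_div) auto
  have "rho s t = \<bar>ln ((1 + t) / (1 - t)) - ln ((1 + s) / (1 - s))\<bar>"
    unfolding rho_def e1 e2 ..
  also have "\<bar>b - a\<bar> = 2 * \<bar>a / 2 - b / 2\<bar>" for a b :: real by (simp add: abs_if)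
  finally show ?thesis unfolding artanh_def .
qed

lemma exp_two_artanh: "s \<in> {-1<..<1} \<Longrightarrow> exp (2 * artanh s) = (1 + s) / (1 - s)" for s :: real
  unfolding artanh_def by simp

definition null_step :: "'n::finite minkowski set \<Rightarrow> 'n minkowski \<Rightarrow> 'n minkowski \<Rightarrow> real \<Rightarrow> bool" where
  "null_step \<Omega> x y d \<longleftrightarrow> (\<exists>\<gamma> s t. proj_lightlike_geodesic \<Omega> \<gamma> \<and> s \<in> {-1<..<1} \<and> t \<in> {-1<..<1} \<and>
     \<gamma> s = x \<and> \<gamma> t = y \<and> d = rho s t)"

text \<open>An inductive form of the families in \<open>chain_lengths\<close>, carrying the total
  length as last argument, so that estimates for one geodesic extend to chains by rule
  induction.\<close>

inductive null_chain :: "'n::finite minkowski set \<Rightarrow> 'n minkowski \<Rightarrow> 'n minkowski \<Rightarrow> real \<Rightarrow> bool"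
  for \<Omega> where
  single: "null_step \<Omega> x y d \<Longrightarrow> null_chain \<Omega> x y d"
| cons: "null_step \<Omega> x y d \<Longrightarrow> null_chain \<Omega> y z l \<Longrightarrow> null_chain \<Omega> x z (d + l)"

lemma null_step_sym: "null_step \<Omega> x y d \<Longrightarrow> null_step \<Omega> y x d"
proof -
  have "rho s t = rho t s" if "s \<in> {-1<..<1}" "t \<in> {-1<..<1}" for s t
    unfolding rho_artanh[OF that] rho_artanh[OF that(2,1)] by (simp only: abs_minus_commute)
  then show "null_step \<Omega> x y d \<Longrightarrow> null_step \<Omega> y x d" unfolding null_step_def by metis
qed

lemma null_step_nonneg: "null_step \<Omega> x y d \<Longrightarrow> 0 \<le> d"
  unfolding null_step_def rho_def by auto

lemma null_step_mem: "null_step \<Omega> x y d \<Longrightarrow> x \<in> \<Omega> \<and> y \<in> \<Omega>"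
  unfolding null_step_def proj_lightlike_geodesic_def by blast

lemma null_step_split:
  assumes "null_step \<Omega> x y d" "0 \<le> a" "a \<le> d"
  obtains z where "null_step \<Omega> x z a" "null_step \<Omega> z y (d - a)"
proof -
  obtain \<gamma> s t where g: "proj_lightlike_geodesic \<Omega> \<gamma>" "s \<in> {-1<..<1}" "t \<in> {-1<..<1}"
     "\<gamma> s = x" "\<gamma> t = y" "d = rho s t" using assms(1) unfolding null_step_def by blast
  \<comment> \<open>The point is found by moving from \<open>artanh s\<close> towards
    \<open>artanh t\<close>; the amount is \<open>a / 2\<close> because \<open>rho\<close> is twice
    the difference of \<open>artanh\<close>.\<close>
  define r where "r = tanh (artanh s + (if artanh s \<le> artanh t then a / 2 else - (a / 2)))"
  have r: "r \<in> {-1<..<1}" unfolding r_def by (rule tanh_real_bounds)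
  have ar: "artanh r = artanh s + (if artanh s \<le> artanh t then a / 2 else - (a / 2))"
    unfolding r_def by (rule artanh_tanh_real)
  have d: "d = 2 * \<bar>artanh s - artanh t\<bar>" unfolding g(6) by (rule rho_artanh[OF g(2,3)])
  have "rho s r = a" unfolding rho_artanh[OF g(2) r] ar using assms(2) by simp
  moreover have "rho r t = d - a"
  proof (cases "artanh s \<le> artanh t")
    case True
    then have "artanh r = artanh s + a / 2" "d = 2 * (artanh t - artanh s)" using ar d by auto
    moreover from this have "\<bar>artanh r - artanh t\<bar> = artanh t - artanh r" using assms(3) by simp
    ultimately show ?thesis unfolding rho_artanh[OF r g(3)] by simp
  next
    case False
    then have "artanh r = artanh s - a / 2" "d = 2 * (artanh s - artanh t)" using ar d by auto
    moreover from this have "\<bar>artanh r - artanh t\<bar> = artanh r - artanh t" using assms(3) by simp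
    ultimately show ?thesis unfolding rho_artanh[OF r g(3)] by simp
  qed
  ultimately have "null_step \<Omega> x (\<gamma> r) a" "null_step \<Omega> (\<gamma> r) y (d - a)"
    unfolding null_step_def using g(1-5) r by metis+
  then show ?thesis by (rule that)
qed

lemma null_chain_append:
  "null_chain \<Omega> x y l \<Longrightarrow> null_chain \<Omega> y z l' \<Longrightarrow> null_chain \<Omega> x z (l + l')"
proof (induction rule: null_chain.induct)
  case (cons x y d w l)
  from null_chain.cons[OF cons.hyps(1) cons.IH[OF cons.prems]] show ?case by (simp add: add.assoc)
qed (rule null_chain.cons)

lemma null_chain_sym: "null_chain \<Omega> x y l \<Longrightarrow> null_chain \<Omega> y x l"
proof (induction rule: null_chain.induct)
  case (cons x y d z l)
  then show ?case
    using null_chain_append[OF cons.IH null_chain.single[OF null_step_sym[OF cons.hyps(1)]]]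
    by (simp add: add.commute)
qed (auto intro: null_chain.single null_step_sym)

lemma null_chain_nonneg: "null_chain \<Omega> x y l \<Longrightarrow> 0 \<le> l"
  by (induction rule: null_chain.induct) (auto dest: null_step_nonneg)

lemma null_chain_mem: "null_chain \<Omega> x y l \<Longrightarrow> x \<in> \<Omega> \<and> y \<in> \<Omega>"
  by (induction rule: null_chain.induct) (auto dest: null_step_mem)

text \<open>Cutting an almost shortest chain in the middle will produce approximate
  midpoints.\<close>

lemma null_chain_split:
  assumes "null_chain \<Omega> x y l" "0 \<le> a" "a \<le> l"
  shows "\<exists>z. null_chain \<Omega> x z a \<and> null_chain \<Omega> z y (l - a)"
  using assms
proof (induction arbitrary: a rule: null_chain.induct)
  case (single x y d)
  then show ?case by (metis null_step_split null_chain.single)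
next
  case (cons x y d z l)
  show ?case
  proof (cases "a \<le> d")
    case True
    then obtain w where "null_step \<Omega> x w a" "null_step \<Omega> w y (d - a)"
      using null_step_split cons by metis
    then have "null_chain \<Omega> x w a" "null_chain \<Omega> w z ((d - a) + l)"
      using cons by (auto intro: null_chain.intros)
    then show ?thesis by (intro exI[of _ w]) (simp add: algebra_simps)
  next
    case False
    then obtain w where "null_chain \<Omega> y w (a - d)" "null_chain \<Omega> w z (l - (a - d))"
      using cons.IH[of "a - d"] cons.prems by auto
    moreover from this have "null_chain \<Omega> x w (d + (a - d))"
      using cons.hyps(1) by (intro null_chain.cons)
    ultimately show ?thesis by (intro exI[of _ w]) (simp add: algebra_simps)
  qed
qed

lemma chain_lengths_eq_null_chain: "chain_lengths \<Omega> x y = {l. null_chain \<Omega> x y l}"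
proof (intro set_eqI iffI)
  fix l assume "l \<in> chain_lengths \<Omega> x y"
  then obtain m :: nat and s t \<gamma> where m: "1 \<le> m" and l: "l = (\<Sum>k=1..m. rho (s k) (t k))"
    and geo: "\<forall>k\<in>{1..m}. proj_lightlike_geodesic \<Omega> (\<gamma> k) \<and> s k \<in> {-1<..<1} \<and> t k \<in> {-1<..<1}"
    and ends: "\<gamma> 1 (s 1) = x" "\<gamma> m (t m) = y"
    and link: "\<forall>k\<in>{1..<m}. \<gamma> k (t k) = \<gamma> (Suc k) (s (Suc k))"
    unfolding chain_lengths_def by blast
  have step: "null_step \<Omega> (\<gamma> k (s k)) (\<gamma> k (t k)) (rho (s k) (t k))" if "k \<in> {1..m}" for k
    using geo that unfolding null_step_def by blast
  have "null_chain \<Omega> x (\<gamma> (Suc j) (t (Suc j))) (\<Sum>k=1..Suc j. rho (s k) (t k))" if "j < m" for j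
    using that
  proof (induction j)
    case 0
    then show ?case using null_chain.single[OF step[of 1]] m ends by simp
  next
    case (Suc j)
    have "null_step \<Omega> (\<gamma> (Suc j) (t (Suc j))) (\<gamma> (Suc (Suc j)) (t (Suc (Suc j)))) (rho (s (Suc (Suc j))) (t (Suc (Suc j))))"
      using link Suc.prems step[of "Suc (Suc j)"] by simp
    from null_chain_append[OF Suc.IH null_chain.single[OF this]] Suc.prems show ?case by simp
  qed
  from this[of "m - 1"]
  show "l \<in> {l. null_chain \<Omega> x y l}" using m ends l by auto
next
  fix l assume "l \<in> {l. null_chain \<Omega> x y l}"
  then have "null_chain \<Omega> x y l" by simp
  then show "l \<in> chain_lengths \<Omega> x y"
  proof (induction rule: null_chain.induct)
    case (single x y d)
    then obtain \<gamma> s t where "proj_lightlike_geodesic \<Omega> \<gamma>" "s \<in> {-1<..<1}" "t \<in> {-1<..<1}"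
       "\<gamma> s = x" "\<gamma> t = y" "d = rho s t" unfolding null_step_def by blast
    then show ?case
      unfolding chain_lengths_def mem_Collect_eq
      by (intro exI[of _ "1::nat"] exI[of _ "\<lambda>_. s"] exI[of _ "\<lambda>_. t"] conjI exI[of _ "\<lambda>_. \<gamma>"]) auto
  next
    case (cons x y d z l)
    obtain \<gamma>0 s0 t0 where g0: "proj_lightlike_geodesic \<Omega> \<gamma>0" "s0 \<in> {-1<..<1}" "t0 \<in> {-1<..<1}"
       "\<gamma>0 s0 = x" "\<gamma>0 t0 = y" "d = rho s0 t0" using cons.hyps(1) unfolding null_step_def by blast
    obtain m :: nat and s t \<gamma> where m: "1 \<le> m" and l: "l = (\<Sum>k=1..m. rho (s k) (t k))"
      and geo: "\<forall>k\<in>{1..m}. proj_lightlike_geodesic \<Omega> (\<gamma> k) \<and> s k \<in> {-1<..<1} \<and> t k \<in> {-1<..<1}"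
      and ends: "\<gamma> 1 (s 1) = y" "\<gamma> m (t m) = z"
      and link: "\<forall>k\<in>{1..<m}. \<gamma> k (t k) = \<gamma> (Suc k) (s (Suc k))"
      using cons.IH unfolding chain_lengths_def by blast
    \<comment> \<open>The new geodesic takes index 1 and the old family is shifted by one.\<close>
    define s' t' \<gamma>' where "s' k = (if k = 1 then s0 else s (k - 1))"
      and "t' k = (if k = 1 then t0 else t (k - 1))" and "\<gamma>' k = (if k = 1 then \<gamma>0 else \<gamma> (k - 1))" for k
    have "(\<Sum>k=1..Suc m. rho (s' k) (t' k)) = rho (s' 1) (t' 1) + (\<Sum>k=Suc 1..Suc m. rho (s' k) (t' k))"
      by (subst sum.atLeast_Suc_atMost) auto
    also have "(\<Sum>k=Suc 1..Suc m. rho (s' k) (t' k)) = l"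
      unfolding l sum.shift_bounds_cl_Suc_ivl by (intro sum.cong) (auto simp: s'_def t'_def)
    finally have sum: "d + l = (\<Sum>k=1..Suc m. rho (s' k) (t' k))"
      using g0 by (simp add: s'_def t'_def)
    have "\<gamma>' k (t' k) = \<gamma>' (Suc k) (s' (Suc k))" if "k \<in> {1..<Suc m}" for k
    proof (cases "k = 1")
      case True
      then show ?thesis using ends m g0 by (simp add: s'_def t'_def \<gamma>'_def)
    next
      case False
      then have "k - 1 \<in> {1..<m}" "Suc (k - 1) = k" using that by auto
      then show ?thesis using link False that by (force simp: s'_def t'_def \<gamma>'_def)
    qed
    moreover have "proj_lightlike_geodesic \<Omega> (\<gamma>' k) \<and> s' k \<in> {-1<..<1} \<and> t' k \<in> {-1<..<1}"
      if "k \<in> {1..Suc m}" for k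
    proof (cases "k = 1")
      case True
      then show ?thesis using g0 by (simp add: s'_def t'_def \<gamma>'_def)
    next
      case False
      then have "k - 1 \<in> {1..m}" using that by auto
      from bspec[OF geo this] False show ?thesis by (simp add: s'_def t'_def \<gamma>'_def)
    qed
    moreover have "\<gamma>' 1 (s' 1) = x" "\<gamma>' (Suc m) (t' (Suc m)) = z"
      using g0 ends m by (auto simp: s'_def t'_def \<gamma>'_def)
    ultimately show ?case unfolding sum chain_lengths_def mem_Collect_eq
      by (intro exI[of _ "Suc m"] exI[of _ s'] exI[of _ t'] conjI exI[of _ \<gamma>'] ballI) auto
  qed
qed

section \<open>The Markowitz distance as an infimum over null chains\<close>

lemma bdd_below_chain_lengths: "bdd_below (chain_lengths \<Omega> x y)"
  unfolding chain_lengths_eq_null_chain by (rule bdd_belowI[of _ 0]) (auto dest: null_chain_nonneg)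

lemma markowitz_dist_le: "null_chain \<Omega> x y l \<Longrightarrow> markowitz_dist \<Omega> x y \<le> l"
  unfolding markowitz_dist_def using bdd_below_chain_lengths[of \<Omega> x y]
  by (auto simp: chain_lengths_eq_null_chain intro: cInf_lower)

text \<open>The chain \<open>l0\<close> excludes the dummy value 0 of the definition.\<close>

lemma markowitz_dist_ge:
  assumes "null_chain \<Omega> x y l0" "\<And>l. null_chain \<Omega> x y l \<Longrightarrow> c \<le> l"
  shows "c \<le> markowitz_dist \<Omega> x y"
  unfolding markowitz_dist_def chain_lengths_eq_null_chain
  using assms by (auto intro!: cInf_greatest)

lemma markowitz_dist_approx:
  assumes "null_chain \<Omega> x y l0" "0 < e"
  obtains l where "null_chain \<Omega> x y l" "l < markowitz_dist \<Omega> x y + e"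
proof -
  have "\<exists>l. null_chain \<Omega> x y l \<and> l < markowitz_dist \<Omega> x y + e"
  proof (rule ccontr)
    assume "\<not> ?thesis"
    then have "markowitz_dist \<Omega> x y + e \<le> markowitz_dist \<Omega> x y"
      by (intro markowitz_dist_ge[OF assms(1)]) force
    then show False using assms(2) by simp
  qed
  then show ?thesis using that by blast
qed

lemma markowitz_dist_nonneg: "0 \<le> markowitz_dist \<Omega> x y"
proof (cases "\<exists>l. null_chain \<Omega> x y l")
  case True
  then show ?thesis using markowitz_dist_ge null_chain_nonneg by blast
next
  case False
  then show ?thesis by (simp add: markowitz_dist_def chain_lengths_eq_null_chain)
qed

lemma markowitz_dist_commute: "markowitz_dist \<Omega> x y = markowitz_dist \<Omega> y x"
proof -
  have "chain_lengths \<Omega> x y = chain_lengths \<Omega> y x"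
    unfolding chain_lengths_eq_null_chain using null_chain_sym by blast
  then show ?thesis unfolding markowitz_dist_def by simp
qed

lemma markowitz_dist_triangle:
  assumes "null_chain \<Omega> x y l" "null_chain \<Omega> y z l'"
  shows "markowitz_dist \<Omega> x z \<le> markowitz_dist \<Omega> x y + markowitz_dist \<Omega> y z"
proof (rule field_le_epsilon)
  fix e :: real assume "0 < e"
  then have "0 < e / 2" by simp
  then obtain a b where "null_chain \<Omega> x y a" "a < markowitz_dist \<Omega> x y + e / 2"
    "null_chain \<Omega> y z b" "b < markowitz_dist \<Omega> y z + e / 2"
    using markowitz_dist_approx assms by metis
  then show "markowitz_dist \<Omega> x z \<le> markowitz_dist \<Omega> x y + markowitz_dist \<Omega> y z + e"
    using markowitz_dist_le[OF null_chain_append] by fastforce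
qed

text \<open>An affine function without zeros on \<open>(-1, 1)\<close> is a combination of \<open>1 + s\<close> and \<open>1 - s\<close>
  with coefficients of the same sign.\<close>

lemma affine_nonvanishing_ratio:
  fixes c d s t :: real
  assumes nz: "\<And>s. s \<in> {-1<..<1} \<Longrightarrow> c * s + d \<noteq> 0" and st: "s \<in> {-1<..<1}" "t \<in> {-1<..<1}" "s \<le> t"
  shows "(c * t + d) / (c * s + d) \<le> (1 + t) / (1 + s) \<and> (c * s + d) / (c * t + d) \<le> (1 - s) / (1 - t)
    \<and> 0 < (c * t + d) / (c * s + d)"
proof -
  have cd: "\<bar>c\<bar> \<le> \<bar>d\<bar>"
  proof (rule ccontr)
    assume *: "\<not> \<bar>c\<bar> \<le> \<bar>d\<bar>"
    then have "\<bar>- d / c\<bar> < 1" by simp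
    then have "- d / c \<in> {-1<..<1}" unfolding abs_less_iff by auto
    from nz[OF this] show False using * by auto
  qed
  have pos: "(c * t + d) / (c * s + d) \<le> (1 + t) / (1 + s) \<and> (c * s + d) / (c * t + d) \<le> (1 - s) / (1 - t)
      \<and> 0 < (c * t + d) / (c * s + d)" if cd: "\<bar>c\<bar> \<le> d" "0 < d" for c d
  proof -
    have pos: "0 < c * r + d" if "r \<in> {-1<..<1}" for r
    proof -
      have "\<bar>c * r\<bar> = \<bar>c\<bar> * \<bar>r\<bar>" by (rule abs_mult)
      also have "\<dots> \<le> d * \<bar>r\<bar>" using cd(1) by (rule mult_right_mono) simp
      also have "\<dots> < d * 1" using cd(2) that by (intro mult_strict_left_mono) auto
      finally show ?thesis by linarith
    qed
    \<comment> \<open>Up to the factor 1/2, \<open>d - c\<close> and \<open>d + c\<close> are the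
      coefficients of \<open>1 - s\<close> and \<open>1 + s\<close> in \<open>c * s + d\<close>. The
      differences of the two sides in the inequalities below are these products.\<close>
    have "0 \<le> (t - s) * (d - c)" "0 \<le> (t - s) * (d + c)" using st cd(1) by auto
    then have "(c * t + d) * (1 + s) \<le> (1 + t) * (c * s + d)"
      "(c * s + d) * (1 - t) \<le> (1 - s) * (c * t + d)" by (auto simp: algebra_simps)
    then show ?thesis using pos[OF st(1)] pos[OF st(2)] st
      by (simp add: pos_divide_le_eq pos_le_divide_eq frac_le_eq divide_le_eq le_divide_eq)
  qed
  have "d \<noteq> 0" using nz[of 0] by simp
  then consider "0 < d" | "d < 0" by linarith
  then show ?thesis
  proof cases
    case 1
    then show ?thesis using pos[of c d] cd by simp
  next
    case 2
    have "(- c * r + - d) / (- c * q + - d) = (c * r + d) / (c * q + d)" for r q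
    proof -
      have "- c * r + - d = - (c * r + d)" "- c * q + - d = - (c * q + d)" by simp_all
      then show ?thesis by (simp only: minus_divide_divide)
    qed
    then show ?thesis using pos[of "- c" "- d"] cd 2 by simp
  qed
qed

section \<open>Comparison with rays and half-spaces\<close>

text \<open>The homography \<open>(1 + s) / (1 - s)\<close> maps the interval onto the positive
  half-line and carries \<open>2 * artanh\<close> to \<open>ln\<close>; \<open>r\<close> is its
  inverse.\<close>

lemma null_step_ray:
  assumes v: "lightlike v" and \<Omega>: "\<And>s. 0 < s \<Longrightarrow> b + s *\<^sub>R v \<in> \<Omega>" and pos: "0 < s1" "0 < s2"
  shows "null_step \<Omega> (b + s1 *\<^sub>R v) (b + s2 *\<^sub>R v) \<bar>ln s1 - ln s2\<bar>"
proof -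
  define r where "r s = (s - 1) / (s + 1)" for s :: real
  have r: "r s \<in> {-1<..<1}" "(r s + 1) / (1 - r s) = s" if "0 < s" for s
    using that by (auto simp: r_def field_simps)
  have "2 * artanh (r s) = ln s" if "0 < s" for s
    using exp_two_artanh[OF r(1)[OF that]] r(2)[OF that] by (metis add.commute ln_exp)
  then have rho: "rho (r s1) (r s2) = \<bar>ln s1 - ln s2\<bar>"
    using pos unfolding rho_artanh[OF r(1)[OF pos(1)] r(1)[OF pos(2)]]
    by (metis abs_mult abs_numeral right_diff_distrib)
  define \<gamma> where "\<gamma> = (\<lambda>s. b + ((1 * s + 1) / ((-1) * s + 1)) *\<^sub>R v)"
  have "\<gamma> s \<in> \<Omega>" if "s \<in> {-1<..<1}" for s
    unfolding \<gamma>_def by (rule \<Omega>) (use that in auto)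
  then have "proj_lightlike_geodesic \<Omega> \<gamma>"
    unfolding proj_lightlike_geodesic_def
    by (intro exI[of _ b] exI[of _ v] exI[of _ 1] exI[of _ 1] exI[of _ "-1"] exI[of _ 1] conjI ballI v)
      (auto simp: \<gamma>_def)
  moreover have "\<gamma> (r s1) = b + s1 *\<^sub>R v" "\<gamma> (r s2) = b + s2 *\<^sub>R v"
    unfolding \<gamma>_def using r(2)[OF pos(1)] r(2)[OF pos(2)] by auto
  ultimately show ?thesis unfolding null_step_def rho[symmetric] using r(1) pos by metis
qed

text \<open>Its positivity set is the open half-space above the graph of the affine function with
  slope \<open>\<xi>\<close> and value \<open>- c\<close> at the origin.\<close>

definition half_space_fun :: "(real, 'n) vec \<Rightarrow> real \<Rightarrow> 'n::finite minkowski \<Rightarrow> real" where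
  "half_space_fun \<xi> c z = fst z - \<xi> \<bullet> snd z + c"

lemma half_space_fun_add:
  "half_space_fun \<xi> c (x + k *\<^sub>R v) = half_space_fun \<xi> c x + k * (fst v - \<xi> \<bullet> snd v)"
  by (simp add: half_space_fun_def inner_add_right algebra_simps)

text \<open>Along a projective parametrization the functional is a quotient of two affine functions
  without zeros on \<open>(-1, 1)\<close>; this is a Schwarz lemma for maps into a half-line.\<close>

lemma null_step_ln_half_space_le:
  assumes "null_step \<Omega> x y l" and pos: "\<And>z. z \<in> \<Omega> \<Longrightarrow> 0 < half_space_fun \<xi> e z"
  shows "\<bar>ln (half_space_fun \<xi> e x) - ln (half_space_fun \<xi> e y)\<bar> \<le> l"
proof -
  obtain \<gamma> s t where g: "proj_lightlike_geodesic \<Omega> \<gamma>" "s \<in> {-1<..<1}" "t \<in> {-1<..<1}"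
     "\<gamma> s = x" "\<gamma> t = y" "l = rho s t" using assms(1) unfolding null_step_def by blast
  obtain x0 v a b c d where v: "\<And>s. s \<in> {-1<..<1} \<Longrightarrow>
      c * s + d \<noteq> 0 \<and> \<gamma> s = x0 + ((a * s + b) / (c * s + d)) *\<^sub>R v \<and> \<gamma> s \<in> \<Omega>"
    using g(1) unfolding proj_lightlike_geodesic_def by blast
  define F where "F s = half_space_fun \<xi> e (\<gamma> s)" for s
  define P Q where "P = half_space_fun \<xi> e x0" and "Q = fst v - \<xi> \<bullet> snd v"
  \<comment> \<open>Coefficients of the numerator of \<open>F\<close> over the common denominator
    \<open>c * s + d\<close>.\<close>
  define A B where "A = P * c + Q * a" and "B = P * d + Q * b"
  have F: "F s = (A * s + B) / (c * s + d)" and Fpos: "0 < F s" and M: "c * s + d \<noteq> 0"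
    if "s \<in> {-1<..<1}" for s
  proof -
    show M: "c * s + d \<noteq> 0" using v[OF that] by simp
    have "F s = P + (a * s + b) / (c * s + d) * Q"
      unfolding F_def P_def Q_def using v[OF that] half_space_fun_add by metis
    then show "F s = (A * s + B) / (c * s + d)"
      using M unfolding A_def B_def by (simp add: field_simps)
    show "0 < F s" unfolding F_def using v[OF that] pos by metis
  qed
  have N: "A * s + B \<noteq> 0" if "s \<in> {-1<..<1}" for s
    using F[OF that] Fpos[OF that] by auto
  have *: "\<bar>ln (F s) - ln (F t)\<bar> \<le> rho s t"
    if st: "s \<in> {-1<..<1}" "t \<in> {-1<..<1}" "s \<le> t" for s t
  proof -
    \<comment> \<open>For \<open>s \<le> t\<close> this is \<open>exp (rho s t)\<close>. The
      numerator and the denominator of \<open>F\<close> each contribute one of its factors to the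
      bound on a quotient of values of \<open>F\<close>.\<close>
    define E where "E = ((1 + t) / (1 + s)) * ((1 - s) / (1 - t))"
    note rN = affine_nonvanishing_ratio[OF N st] and rM = affine_nonvanishing_ratio[OF M st]
    have inv: "0 < (c * s + d) / (c * t + d)" "0 < (A * s + B) / (A * t + B)"
      using rM rN by (auto simp add: zero_less_divide_iff)
    have "F t / F s = ((A * t + B) / (A * s + B)) * ((c * s + d) / (c * t + d))"
      unfolding F[OF st(1)] F[OF st(2)] by simp
    also have "\<dots> \<le> E" unfolding E_def using rN rM inv st by (intro mult_mono) auto
    finally have 1: "F t / F s \<le> E" .
    have "F s / F t = ((A * s + B) / (A * t + B)) * ((c * t + d) / (c * s + d))"
      unfolding F[OF st(1)] F[OF st(2)] by simp
    also have "\<dots> \<le> ((1 - s) / (1 - t)) * ((1 + t) / (1 + s))"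
      using rN rM inv st by (intro mult_mono) auto
    finally have 2: "F s / F t \<le> E" unfolding E_def by (simp only: mult.commute)
    have "E = exp (2 * artanh t) / exp (2 * artanh s)"
      unfolding exp_two_artanh[OF st(1)] exp_two_artanh[OF st(2)] E_def using st by simp
    then have "E = exp (2 * artanh t - 2 * artanh s)" by (simp only: exp_diff)
    then have "ln E = 2 * (artanh t - artanh s)" by simp
    then have "ln E \<le> rho s t" unfolding rho_artanh[OF st(1,2)] by (simp add: abs_if)
    moreover have "ln (F t / F s) \<le> ln E" "ln (F s / F t) \<le> ln E"
      using 1 2 Fpos[OF st(1)] Fpos[OF st(2)] by (auto intro!: ln_mono)
    ultimately show ?thesis
      using ln_divide_pos[OF Fpos[OF st(1)] Fpos[OF st(2)]] ln_divide_pos[OF Fpos[OF st(2)] Fpos[OF st(1)]]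
      by linarith
  qed
  have sym: "rho s t = rho t s"
    unfolding rho_artanh[OF g(2,3)] rho_artanh[OF g(3,2)] by (simp only: abs_minus_commute)
  show ?thesis
  proof (cases "s \<le> t")
    case True
    then show ?thesis using *[OF g(2,3)] g unfolding F_def by simp
  next
    case False
    then have "t \<le> s" by simp
    from *[OF g(3,2) this] show ?thesis
      unfolding F_def g(4-6) sym by (simp only: abs_minus_commute)
  qed
qed

lemma null_chain_ln_half_space_le:
  assumes "null_chain \<Omega> x y l" and "\<And>z. z \<in> \<Omega> \<Longrightarrow> 0 < half_space_fun \<xi> e z"
  shows "\<bar>ln (half_space_fun \<xi> e x) - ln (half_space_fun \<xi> e y)\<bar> \<le> l"
  using assms(1)
proof (induction rule: null_chain.induct)
  case (cons x y d z l)
  then show ?case using null_step_ln_half_space_le[OF cons.hyps(1) assms(2)] by linarith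
qed (rule null_step_ln_half_space_le[OF _ assms(2)])

section \<open>Epigraphs\<close>

text \<open>Convexity is only used through the existence of subgradients.\<close>

locale epigraph_domain =
  fixes f :: "(real, 'n::finite) vec \<Rightarrow> real" and \<Omega> :: "'n minkowski set"
  assumes epi: "\<Omega> = {x. f (snd x) < fst x}"
    and lip: "\<And>p q. \<bar>f p - f q\<bar> \<le> norm (p - q)"
    and subgrad: "\<And>p. \<exists>\<xi>. \<forall>q. f p + \<xi> \<bullet> (q - p) \<le> f q"
begin

abbreviation \<delta> :: "'n minkowski \<Rightarrow> 'n minkowski \<Rightarrow> real" where "\<delta> \<equiv> markowitz_dist \<Omega>"

definition height :: "'n minkowski \<Rightarrow> real" where "height x = fst x - f (snd x)"

lemma mem_iff_height: "x \<in> \<Omega> \<longleftrightarrow> 0 < height x"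
  unfolding epi height_def by simp

lemma height_pos: "x \<in> \<Omega> \<Longrightarrow> 0 < height x"
  unfolding mem_iff_height .

lemma height_add_ge: "height x + fst v - norm (snd v) \<le> height (x + v)"
  using lip[of "snd x + snd v" "snd x"] unfolding height_def by auto

lemma add_causal_mem: "x \<in> \<Omega> \<Longrightarrow> norm (snd v) \<le> fst v \<Longrightarrow> x + v \<in> \<Omega>"
  using height_add_ge[of x v] unfolding mem_iff_height by linarith

section \<open>Upper bounds from explicit null chains\<close>

lemma lightlike_unit: "norm u = 1 \<Longrightarrow> lightlike (1, u)"
  unfolding lightlike_def mink_eps_def by (auto simp: dot_square_norm zero_prod_def)

text \<open>Going back by \<open>k\<close> along a lightlike vector lowers the height by at most
  \<open>2 * k\<close>. So the ray may start \<open>height x / 2\<close> before \<open>x\<close>,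
  and \<open>x\<close> and the end point have the ray parameters \<open>k\<close> and
  \<open>k + s\<close>.\<close>

lemma null_chain_up:
  assumes x: "x \<in> \<Omega>" and u: "norm u = 1" and s: "0 \<le> s"
  shows "null_chain \<Omega> x (x + s *\<^sub>R (1, u)) (ln (1 + 2 * s / height x))"
proof -
  define k where "k = height x / 2"
  have k: "0 < k" using height_pos[OF x] k_def by simp
  have "x - k *\<^sub>R (1, u) + r *\<^sub>R (1, u) \<in> \<Omega>" if "0 < r" for r
  proof -
    have "x - k *\<^sub>R (1, u) + r *\<^sub>R (1, u) = x + (r - k) *\<^sub>R (1, u)"
      by (simp add: algebra_simps)
    moreover have "height x + (r - k) - \<bar>r - k\<bar> \<le> height (x + (r - k) *\<^sub>R (1, u))"
      using height_add_ge[of x "(r - k) *\<^sub>R (1, u)"] u by simp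
    moreover have "0 < height x + (r - k) - \<bar>r - k\<bar>" using that k unfolding k_def by linarith
    ultimately show ?thesis unfolding mem_iff_height by (simp only:)
  qed
  from null_step_ray[OF lightlike_unit[OF u] this, of k "k + s"]
  have "null_step \<Omega> (x - k *\<^sub>R (1, u) + k *\<^sub>R (1, u)) (x - k *\<^sub>R (1, u) + (k + s) *\<^sub>R (1, u)) \<bar>ln k - ln (k + s)\<bar>"
    using k s by simp
  moreover have "x - k *\<^sub>R (1, u) + (k + s) *\<^sub>R (1, u) = x + s *\<^sub>R (1, u)"
    unfolding scaleR_left_distrib by (simp only: diff_add_cancel add.assoc[symmetric])
  ultimately have "null_step \<Omega> x (x + s *\<^sub>R (1, u)) \<bar>ln k - ln (k + s)\<bar>"
    by (simp only: diff_add_cancel)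
  moreover have "\<bar>ln k - ln (k + s)\<bar> = ln (1 + 2 * s / height x)"
  proof -
    have "ln k \<le> ln (k + s)" using k s by simp
    then have "\<bar>ln k - ln (k + s)\<bar> = ln ((k + s) / k)" using k s by (simp add: ln_divide_pos)
    also have "(k + s) / k = 1 + 2 * s / height x" using k by (simp add: add_divide_distrib k_def)
    finally show ?thesis .
  qed
  ultimately show ?thesis using null_chain.single by metis
qed

lemma null_chain_refl: "x \<in> \<Omega> \<Longrightarrow> null_chain \<Omega> x x 0"
  using null_chain_up[of x "axis undefined 1" 0] by (simp add: norm_axis_1 zero_prod_def[symmetric])

text \<open>A causal vector is a sum \<open>a (1, u) + b (1, - u)\<close> with
  \<open>0 \<le> b \<le> a\<close>. The longer leg is taken first: along it the height grows at rate
  at least \<open>1 - L\<close>, which makes the second leg cheap when \<open>L < 1\<close>.\<close>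

lemma null_chain_causal:
  assumes x: "x \<in> \<Omega>" and P: "norm P \<le> T" and L: "\<And>p q. \<bar>f p - f q\<bar> \<le> L * norm (p - q)" and "L \<le> 1"
  shows "\<exists>a b l. 0 \<le> b \<and> b \<le> a \<and> a \<le> T \<and> null_chain \<Omega> x (x + (T, P)) l \<and>
    l \<le> ln (1 + 2 * a / height x) + ln (1 + 2 * b / (height x + (1 - L) * a))"
proof -
  obtain u :: "(real, 'n) vec" where u: "norm u = 1" "P = norm P *\<^sub>R u"
  proof (cases "P = 0")
    case True
    then show ?thesis using that[of "axis undefined 1"] by (simp add: norm_axis_1)
  next
    case False
    then show ?thesis using that[of "P /\<^sub>R norm P"] by simp
  qed
  define a b where "a = (T + norm P) / 2" and "b = (T - norm P) / 2"
  have ab: "0 \<le> b" "b \<le> a" "a \<le> T" using P unfolding a_def b_def by auto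
  define y where "y = x + a *\<^sub>R (1, u)"
  have "y \<in> \<Omega>" unfolding y_def by (rule add_causal_mem[OF x]) (use u ab in simp)
  have "y + b *\<^sub>R (1, - u) = x + (T, P)"
  proof -
    have "a *\<^sub>R u - b *\<^sub>R u = (a - b) *\<^sub>R u" by (simp add: algebra_simps)
    also have "a - b = norm P" unfolding a_def b_def by (simp add: field_simps)
    finally have "a *\<^sub>R u - b *\<^sub>R u = P" using u by simp
    moreover have "a + b = T" unfolding a_def b_def by (simp add: field_simps)
    ultimately show ?thesis unfolding y_def by (simp add: prod_eq_iff algebra_simps)
  qed
  moreover have "null_chain \<Omega> x y (ln (1 + 2 * a / height x))"
    unfolding y_def by (rule null_chain_up[OF x u(1)]) (use ab in simp)
  moreover have "null_chain \<Omega> y (y + b *\<^sub>R (1, - u)) (ln (1 + 2 * b / height y))"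
    by (rule null_chain_up[OF \<open>y \<in> \<Omega>\<close>]) (use ab u in simp_all)
  ultimately have "null_chain \<Omega> x (x + (T, P)) (ln (1 + 2 * a / height x) + ln (1 + 2 * b / height y))"
    using null_chain_append by metis
  moreover have "ln (1 + 2 * b / height y) \<le> ln (1 + 2 * b / (height x + (1 - L) * a))"
  proof -
    have "f (snd y) - f (snd x) \<le> L * a" using L[of "snd y" "snd x"] u ab unfolding y_def by simp
    then have "height x + (1 - L) * a \<le> height y"
      unfolding height_def y_def by (simp add: algebra_simps)
    moreover have "0 < height x + (1 - L) * a"
      using height_pos[OF x] \<open>L \<le> 1\<close> ab by (simp add: add_pos_nonneg)
    ultimately have "2 * b / height y \<le> 2 * b / (height x + (1 - L) * a)"
      using ab by (intro divide_left_mono) (auto intro: mult_pos_pos)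
    moreover have "0 \<le> 2 * b / height y" using ab height_pos[OF \<open>y \<in> \<Omega>\<close>] by simp
    ultimately show ?thesis by simp
  qed
  ultimately show ?thesis
    using ab by (intro exI[of _ a] exI[of _ b] exI conjI) (auto intro: add_left_mono)
qed

text \<open>The lowest point vertically above or at \<open>x\<close> that lies in the closed future
  cone of \<open>y\<close>. Both points thus reach it by a future causal displacement or the zero
  one.\<close>

definition join_pt :: "'n minkowski \<Rightarrow> 'n minkowski \<Rightarrow> 'n minkowski" where
  "join_pt x y = (max (fst x) (fst y + norm (snd x - snd y)), snd x)"

lemma join_pt_diff:
  obtains S T Q where "join_pt x y = x + (S, 0)" "join_pt x y = y + (T, Q)" "0 \<le> S" "norm Q \<le> T"
    "S \<le> \<bar>fst x - fst y\<bar> + norm (snd x - snd y)" "T \<le> \<bar>fst x - fst y\<bar> + norm (snd x - snd y)"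
    "S = fst (join_pt x y) - fst x" "T = fst (join_pt x y) - fst y"
proof (rule that)
  show "join_pt x y = x + (fst (join_pt x y) - fst x, 0)"
    "join_pt x y = y + (fst (join_pt x y) - fst y, snd x - snd y)"
    by (simp_all add: prod_eq_iff join_pt_def)
  have m: "max a (b + c) - a \<le> \<bar>a - b\<bar> + c" "max a (b + c) - b \<le> \<bar>a - b\<bar> + c"
    if "0 \<le> c" for a b c :: real using that by (auto simp: max_def abs_if)
  show "fst (join_pt x y) - fst x \<le> \<bar>fst x - fst y\<bar> + norm (snd x - snd y)"
    "fst (join_pt x y) - fst y \<le> \<bar>fst x - fst y\<bar> + norm (snd x - snd y)"
    unfolding join_pt_def fst_conv by (rule m; simp)+
qed (auto simp: join_pt_def)

lemma null_chain_exists: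
  assumes "x \<in> \<Omega>" "y \<in> \<Omega>"
  obtains l where "null_chain \<Omega> x y l"
proof -
  obtain S T Q where z: "join_pt x y = x + (S, 0)" "join_pt x y = y + (T, Q)" "0 \<le> S" "norm Q \<le> T"
    by (rule join_pt_diff)
  have "\<exists>l. null_chain \<Omega> x (join_pt x y) l"
    unfolding z(1) using null_chain_causal[OF assms(1), of 0 S 1] z lip by auto
  moreover have "\<exists>l. null_chain \<Omega> y (join_pt x y) l"
    unfolding z(2) using null_chain_causal[OF assms(2), of Q T 1] z lip by auto
  ultimately show ?thesis using that null_chain_append null_chain_sym by meson
qed

lemma dist_nonneg: "0 \<le> \<delta> x y"
  by (rule markowitz_dist_nonneg)

lemma dist_triangle: "x \<in> \<Omega> \<Longrightarrow> y \<in> \<Omega> \<Longrightarrow> z \<in> \<Omega> \<Longrightarrow> \<delta> x z \<le> \<delta> x y + \<delta> y z"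
  using markowitz_dist_triangle null_chain_exists by metis

lemma dist_self: "x \<in> \<Omega> \<Longrightarrow> \<delta> x x = 0"
  using markowitz_dist_le[OF null_chain_refl] markowitz_dist_nonneg order_antisym by blast

section \<open>Lower bounds from supporting half-spaces, and continuity\<close>

lemma dist_ge_ln_half_space:
  assumes "x \<in> \<Omega>" "y \<in> \<Omega>" and "\<And>z. z \<in> \<Omega> \<Longrightarrow> 0 < half_space_fun \<xi> e z"
  shows "\<bar>ln (half_space_fun \<xi> e x) - ln (half_space_fun \<xi> e y)\<bar> \<le> \<delta> x y"
  using null_chain_exists[OF assms(1,2)] markowitz_dist_ge null_chain_ln_half_space_le[OF _ assms(3)] by metis

text \<open>The affine minorant of \<open>f\<close> given by a subgradient at \<open>p\<close>. The
  functional dominates the height, hence is positive on \<open>\<Omega>\<close>, and agrees with it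
  on the vertical line over \<open>p\<close>.\<close>

lemma support_half_space:
  obtains \<xi> e where "\<And>z. height z \<le> half_space_fun \<xi> e z"
    "\<And>z. snd z = p \<Longrightarrow> half_space_fun \<xi> e z = height z" "\<And>q. f p + \<xi> \<bullet> (q - p) \<le> f q"
proof -
  obtain \<xi> where \<xi>: "\<And>q. f p + \<xi> \<bullet> (q - p) \<le> f q" using subgrad by blast
  show ?thesis
    by (rule that[of \<xi> "\<xi> \<bullet> p - f p"])
      (use \<xi> in \<open>auto simp: half_space_fun_def height_def inner_diff_right algebra_simps\<close>)
qed

text \<open>The functional supporting over \<open>x\<close> equals the height at \<open>x\<close>
  and is at least the height at \<open>y\<close>, which gives one sign; exchanging the points gives
  the other.\<close>

lemma ln_height_le_dist:
  assumes "x \<in> \<Omega>" "y \<in> \<Omega>"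
  shows "\<bar>ln (height x) - ln (height y)\<bar> \<le> \<delta> x y"
proof -
  have *: "ln (height y) - ln (height x) \<le> \<delta> x y" if xy: "x \<in> \<Omega>" "y \<in> \<Omega>" for x y
  proof -
    obtain \<xi> e where s: "\<And>z. height z \<le> half_space_fun \<xi> e z" "half_space_fun \<xi> e x = height x"
      using support_half_space[of "snd x"] by metis
    have pos: "0 < half_space_fun \<xi> e z" if "z \<in> \<Omega>" for z
      using s(1)[of z] height_pos[OF that] by linarith
    have "ln (height y) \<le> ln (half_space_fun \<xi> e y)"
      using s(1)[of y] height_pos[OF xy(2)] by (intro ln_mono) auto
    moreover have "\<bar>ln (half_space_fun \<xi> e x) - ln (half_space_fun \<xi> e y)\<bar> \<le> \<delta> x y"
      by (rule dist_ge_ln_half_space[OF xy]) (rule pos)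
    ultimately show ?thesis unfolding s(2) abs_le_iff by linarith
  qed
  show ?thesis using *[OF assms] *[OF assms(2,1)] markowitz_dist_commute[of \<Omega> x y] by linarith
qed

lemma height_le_exp_dist:
  assumes "x \<in> \<Omega>" "y \<in> \<Omega>" shows "height y \<le> height x * exp (\<delta> x y)"
proof -
  have "ln (height y) \<le> ln (height x) + \<delta> x y" using ln_height_le_dist[OF assms] by linarith
  then have "exp (ln (height y)) \<le> exp (ln (height x) + \<delta> x y)" by simp
  then show ?thesis using height_pos assms by (simp add: exp_add)
qed

text \<open>Through \<open>join_pt\<close>, with the constant \<open>L = 1\<close> in
  \<open>null_chain_causal\<close>. The bound tends to 0 with \<open>D\<close> as long as the
  heights stay away from 0, so Euclidean convergence in \<open>\<Omega>\<close> implies convergence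
  for \<open>\<delta>\<close>.\<close>

lemma dist_le_local:
  assumes x: "x \<in> \<Omega>" and y: "y \<in> \<Omega>" and D: "D = \<bar>fst x - fst y\<bar> + norm (snd x - snd y)"
  shows "\<delta> x y \<le> 2 * ln (1 + 2 * D / height x) + 2 * ln (1 + 2 * D / height y)"
proof -
  obtain S T Q where z: "join_pt x y = x + (S, 0)" "join_pt x y = y + (T, Q)" "0 \<le> S" "norm Q \<le> T"
    "S \<le> D" "T \<le> D"
    unfolding D by (rule join_pt_diff)
  have *: "\<delta> w (w + (S, Q)) \<le> 2 * ln (1 + 2 * D / height w)"
    if w: "w \<in> \<Omega>" "norm Q \<le> S" "S \<le> D" for w S and Q :: "(real, 'n) vec"
  proof -
    obtain a b l where l: "0 \<le> b" "b \<le> a" "a \<le> S" "null_chain \<Omega> w (w + (S, Q)) l"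
      "l \<le> ln (1 + 2 * a / height w) + ln (1 + 2 * b / (height w + (1 - 1) * a))"
      using null_chain_causal[OF w(1,2), of 1] lip by auto
    have "ln (1 + 2 * c / height w) \<le> ln (1 + 2 * D / height w)" if "0 \<le> c" "c \<le> D" for c
      using that height_pos[OF w(1)] by (intro ln_mono) (auto simp: divide_right_mono add_pos_nonneg)
    from this[of a] this[of b] show ?thesis
      using markowitz_dist_le[OF l(4)] l w by simp
  qed
  have "join_pt x y \<in> \<Omega>" unfolding z(1) by (rule add_causal_mem[OF x]) (use z in simp)
  then have "\<delta> x y \<le> \<delta> x (join_pt x y) + \<delta> y (join_pt x y)"
    using dist_triangle[OF x _ y, of "join_pt x y"] markowitz_dist_commute[of \<Omega> "join_pt x y" y] by simp
  moreover have "\<delta> x (join_pt x y) \<le> 2 * ln (1 + 2 * D / height x)"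
    unfolding z(1) using *[OF x, of 0 S] z by simp
  moreover have "\<delta> y (join_pt x y) \<le> 2 * ln (1 + 2 * D / height y)"
    unfolding z(2) using *[OF y, of Q T] z by simp
  ultimately show ?thesis by linarith
qed

lemma continuous_f: "continuous_on UNIV f"
proof -
  have "1-lipschitz_on UNIV f" unfolding lipschitz_on_def using lip by (auto simp: dist_norm)
  then show ?thesis by (rule lipschitz_on_continuous_on)
qed

lemma continuous_height: "continuous_on UNIV height"
  unfolding height_def
  by (intro continuous_intros continuous_on_compose2[OF continuous_f]) auto

lemma tendsto_height: "(g \<longlongrightarrow> l) F \<Longrightarrow> ((\<lambda>n. height (g n)) \<longlongrightarrow> height l) F"
  by (rule continuous_on_tendsto_compose[OF continuous_height]) simp_all

lemma tendsto_dist_zero: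
  assumes lim: "(g \<longlongrightarrow> l) sequentially" and g: "\<And>n. g n \<in> \<Omega>" and l: "l \<in> \<Omega>"
  shows "(\<lambda>n. \<delta> (g n) l) \<longlonglongrightarrow> 0"
proof -
  define D where "D n = \<bar>fst (g n) - fst l\<bar> + norm (snd (g n) - snd l)" for n
  have "D \<longlonglongrightarrow> \<bar>fst l - fst l\<bar> + norm (snd l - snd l)"
    unfolding D_def by (intro tendsto_intros lim)
  then have D: "D \<longlonglongrightarrow> 0" by simp
  have "(\<lambda>n. 2 * ln (1 + 2 * D n / height (g n)) + 2 * ln (1 + 2 * D n / height l)) \<longlonglongrightarrow>
      2 * ln (1 + 2 * 0 / height l) + 2 * ln (1 + 2 * 0 / height l)"
    by (intro tendsto_intros D tendsto_height lim) (use height_pos[OF l] in auto)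
  then have U: "(\<lambda>n. 2 * ln (1 + 2 * D n / height (g n)) + 2 * ln (1 + 2 * D n / height l)) \<longlonglongrightarrow> 0"
    by simp
  show ?thesis
    by (rule tendsto_sandwich[OF _ _ tendsto_const U])
      (use dist_le_local[OF g l D_def] in \<open>simp_all add: markowitz_dist_nonneg\<close>)
qed

end

section \<open>Spacelike boundary\<close>

locale spacelike_epigraph = epigraph_domain +
  fixes L :: real
  assumes L: "0 \<le> L" "L < 1" and lipL: "\<And>p q. \<bar>f p - f q\<bar> \<le> L * norm (p - q)"
begin

lemma norm_subgradient_le:
  assumes "\<And>q. f p + \<xi> \<bullet> (q - p) \<le> f q"
  shows "norm \<xi> \<le> L"
proof -
  have "f p + \<xi> \<bullet> \<xi> \<le> f (p + \<xi>)" using assms[of "p + \<xi>"] by simp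
  then have "norm \<xi> * norm \<xi> \<le> L * norm \<xi>"
    using lipL[of "p + \<xi>" p] by (simp add: dot_square_norm power2_eq_square)
  then show ?thesis using L by (cases "\<xi> = 0") auto
qed

text \<open>A lightlike displacement has \<open>norm P = \<bar>T\<bar>\<close>, and
  \<open>norm \<xi> \<le> L\<close>, so the functional supporting over \<open>x\<close> changes by
  at least \<open>(1 - L) * norm P\<close>. Its logarithm changes by at most \<open>l\<close>,
  starting from the value \<open>height x\<close>.\<close>

lemma null_step_displacement:
  assumes step: "null_step \<Omega> x y l"
  shows "(1 - L) * norm (snd x - snd y) \<le> height x * (exp l - 1)"
proof -
  have xy: "x \<in> \<Omega>" "y \<in> \<Omega>" using null_step_mem[OF step] by auto
  obtain \<gamma> s t where g: "proj_lightlike_geodesic \<Omega> \<gamma>" "s \<in> {-1<..<1}" "t \<in> {-1<..<1}" "\<gamma> s = x" "\<gamma> t = y"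
    using step unfolding null_step_def by blast
  then obtain x0 v a b where v: "lightlike v" "x = x0 + a *\<^sub>R v" "y = x0 + b *\<^sub>R v"
    unfolding proj_lightlike_geodesic_def by metis
  have nv: "norm (snd v) = \<bar>fst v\<bar>"
  proof -
    have "(norm (snd v))\<^sup>2 = (fst v)\<^sup>2"
      unfolding power2_norm_eq_inner using v(1) unfolding lightlike_def mink_eps_def
      by (simp add: power2_eq_square)
    then show ?thesis by (metis abs_norm_cancel power2_eq_iff_nonneg abs_ge_zero norm_ge_zero power2_abs)
  qed
  define T P where "T = fst y - fst x" and "P = snd y - snd x"
  have "T = (b - a) * fst v" "P = (b - a) *\<^sub>R snd v"
    unfolding T_def P_def v by (simp_all add: algebra_simps)
  then have TP: "norm P = \<bar>T\<bar>" using nv by (simp add: abs_mult)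
  obtain \<xi> e where sup: "\<And>z. height z \<le> half_space_fun \<xi> e z" "\<And>z. snd z = snd x \<Longrightarrow> half_space_fun \<xi> e z = height z"
    "\<And>q. f (snd x) + \<xi> \<bullet> (q - snd x) \<le> f q"
    using support_half_space[of "snd x"] by metis
  let ?\<phi> = "half_space_fun \<xi> e"
  have pos: "0 < ?\<phi> z" if "z \<in> \<Omega>" for z using sup(1)[of z] height_pos[OF that] by linarith
  have \<phi>x: "?\<phi> x = height x" by (rule sup(2)) simp
  have \<phi>y: "?\<phi> y = height x + T - \<xi> \<bullet> P"
    unfolding \<phi>x[symmetric] half_space_fun_def T_def P_def by (simp add: inner_diff_right)
  have "\<bar>\<xi> \<bullet> P\<bar> \<le> norm \<xi> * norm P" by (rule Cauchy_Schwarz_ineq2)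
  also have "\<dots> \<le> L * norm P" using norm_subgradient_le[OF sup(3)] by (intro mult_right_mono) auto
  finally have xiP: "\<bar>\<xi> \<bullet> P\<bar> \<le> L * norm P" .
  have l: "\<bar>ln (height x) - ln (?\<phi> y)\<bar> \<le> l"
    using null_step_ln_half_space_le[OF step pos] \<phi>x by simp
  have hx: "0 < height x" using height_pos xy by simp
  have hy: "0 < ?\<phi> y" using pos xy by simp
  have "(1 - L) * norm P \<le> height x * (exp l - 1)"
  proof (cases "0 \<le> T")
    case True
    have "ln (?\<phi> y) \<le> ln (height x) + l" using l by linarith
    then have "exp (ln (?\<phi> y)) \<le> exp (ln (height x) + l)" by simp
    then have "?\<phi> y \<le> height x * exp l" using hx hy by (simp add: exp_add)
    then show ?thesis using \<phi>y xiP TP True by (simp add: algebra_simps abs_le_iff)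
  next
    case False
    have "ln (height x) - l \<le> ln (?\<phi> y)" using l by linarith
    then have "exp (ln (height x) - l) \<le> exp (ln (?\<phi> y))" by simp
    then have "height x * exp (- l) \<le> ?\<phi> y" using hx hy by (simp add: exp_diff exp_minus field_simps)
    then have "(1 - L) * norm P \<le> height x * (1 - exp (- l))"
      using \<phi>y xiP TP False by (simp add: algebra_simps abs_le_iff)
    also have "\<dots> \<le> height x * (exp l - 1)"
    proof -
      have "2 \<le> exp l + exp (- l)"
        using exp_ge_add_one_self[of l] exp_ge_add_one_self[of "- l"] by linarith
      then show ?thesis using hx by (intro mult_left_mono) auto
    qed
    finally show ?thesis .
  qed
  then show ?thesis unfolding P_def by (simp add: norm_minus_commute)
qed

text \<open>After a step of length \<open>d\<close> the height has grown at most by the factor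
  \<open>exp d\<close>, so the bounds of the single steps telescope.\<close>

lemma null_chain_displacement:
  assumes "null_chain \<Omega> x y l"
  shows "(1 - L) * norm (snd x - snd y) \<le> height x * (exp l - 1)"
  using assms
proof (induction rule: null_chain.induct)
  case (cons x y d z l)
  have xy: "x \<in> \<Omega>" "y \<in> \<Omega>" using null_step_mem[OF cons.hyps(1)] by auto
  have "height y \<le> height x * exp (\<delta> x y)" by (rule height_le_exp_dist[OF xy])
  also have "\<dots> \<le> height x * exp d"
    using markowitz_dist_le[OF null_chain.single[OF cons.hyps(1)]] height_pos[OF xy(1)]
    by (intro mult_left_mono) auto
  finally have hy: "height y \<le> height x * exp d" .
  have "norm (snd x - snd z) \<le> norm (snd x - snd y) + norm (snd y - snd z)"
    using norm_triangle_ineq[of "snd x - snd y" "snd y - snd z"] by simp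
  then have "(1 - L) * norm (snd x - snd z) \<le> (1 - L) * norm (snd x - snd y) + (1 - L) * norm (snd y - snd z)"
    using L by (simp add: distrib_left[symmetric] mult_left_mono)
  also have "\<dots> \<le> height x * (exp d - 1) + height y * (exp l - 1)"
    using null_step_displacement[OF cons.hyps(1)] cons.IH by linarith
  also have "\<dots> \<le> height x * (exp d - 1) + height x * exp d * (exp l - 1)"
    using hy null_chain_nonneg[OF cons.hyps(2)] by (intro add_left_mono mult_right_mono) auto
  also have "\<dots> = height x * (exp (d + l) - 1)" by (simp add: exp_add algebra_simps)
  finally show ?case .
qed (rule null_step_displacement)

lemma dist_displacement:
  assumes x: "x \<in> \<Omega>" and y: "y \<in> \<Omega>"
  shows "(1 - L) * norm (snd x - snd y) \<le> height x * (exp (\<delta> x y) - 1)"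
proof -
  define r where "r = (1 - L) * norm (snd x - snd y) / height x"
  have hx: "0 < height x" using height_pos[OF x] .
  have r: "0 \<le> r" unfolding r_def using hx L by simp
  obtain l0 where l0: "null_chain \<Omega> x y l0" using null_chain_exists[OF x y] .
  \<comment> \<open>Solved for the length, the displacement bound passes to the infimum over
    chains.\<close>
  have "ln (1 + r) \<le> \<delta> x y"
  proof (rule markowitz_dist_ge[OF l0])
    fix l assume "null_chain \<Omega> x y l"
    from null_chain_displacement[OF this] have "1 + r \<le> exp l"
      unfolding r_def using hx by (simp add: field_simps)
    then have "ln (1 + r) \<le> ln (exp l)" using r by (intro ln_mono) auto
    then show "ln (1 + r) \<le> l" by simp
  qed
  then have "exp (ln (1 + r)) \<le> exp (\<delta> x y)" by simp
  then have "r \<le> exp (\<delta> x y) - 1" using r by simp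
  then show ?thesis unfolding r_def using hx by (simp add: field_simps)
qed

section \<open>The distance as a proper geodesic metric\<close>

lemma Metric_space_dist: "Metric_space \<Omega> \<delta>"
proof
  show "\<delta> x y = 0 \<longleftrightarrow> x = y" if "x \<in> \<Omega>" "y \<in> \<Omega>" for x y
  proof
    assume 0: "\<delta> x y = 0"
    then have "(1 - L) * norm (snd x - snd y) \<le> 0" using dist_displacement[OF that] by simp
    then have s: "snd x = snd y" using L by (simp add: mult_le_0_iff)
    have "ln (height x) = ln (height y)" using ln_height_le_dist[OF that] 0 by simp
    then have "height x = height y" using height_pos that by simp
    then show "x = y" using s unfolding height_def by (simp add: prod_eq_iff)
  qed (use dist_self that in auto)
qed (use dist_nonneg markowitz_dist_commute dist_triangle in auto)

sublocale Metric_space \<Omega> \<delta> by (rule Metric_space_dist)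

lemma limitin_dist:
  assumes "g \<longlonglongrightarrow> l" "\<And>n. g n \<in> \<Omega>" "l \<in> \<Omega>"
  shows "limitin mtopology g l sequentially"
  unfolding limitin_metric_dist_null using tendsto_dist_zero[OF assms] assms by simp

text \<open>A ball for \<open>\<delta>\<close> lies in a Euclidean compact set \<open>K\<close>
  contained in \<open>\<Omega>\<close>: heights and horizontal displacements are controlled by the
  distance. Euclidean limits are then limits for \<open>\<delta>\<close>.\<close>

lemma compactin_mcball:
  assumes x: "x \<in> \<Omega>"
  shows "compactin mtopology (mcball x r)"
  unfolding compactin_sequentially
proof (intro conjI allI impI)
  show "mcball x r \<subseteq> \<Omega>" by auto
  fix g :: "nat \<Rightarrow> 'a minkowski" assume "range g \<subseteq> mcball x r"
  then have "g n \<in> mcball x r" for n by blast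
  then have g: "g n \<in> \<Omega>" "\<delta> x (g n) \<le> r" for n by simp_all
  have hx: "0 < height x" using height_pos[OF x] .
  define A where "A = height x * (exp r - 1) / (1 - L)"
  \<comment> \<open>The positive lower bound on the height keeps limits away from the
    boundary.\<close>
  define K where "K = {y. height x * exp (- r) \<le> height y \<and> height y \<le> height x * exp r \<and> norm (snd x - snd y) \<le> A}"
  have "closed K"
    unfolding K_def
    by (intro closed_Collect_conj closed_Collect_le continuous_intros continuous_height)
  have "bounded K"
  proof -
    define B where "B = norm (snd x) + A"
    have "norm y \<le> height x * exp r + (\<bar>f 0\<bar> + B) + B" if "y \<in> K" for y
    proof -
      have y: "height y \<le> height x * exp r" "0 \<le> height y" "norm (snd x - snd y) \<le> A"
        using that hx unfolding K_def by (auto intro: order_trans[rotated])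
      have B: "norm (snd y) \<le> B"
        unfolding B_def using y(3) norm_triangle_ineq2[of "snd y" "snd x"] by (simp add: norm_minus_commute)
      have "\<bar>fst y\<bar> \<le> height y + \<bar>f (snd y)\<bar>" using y(2) unfolding height_def by linarith
      also have "\<dots> \<le> height x * exp r + (\<bar>f 0\<bar> + B)" using lip[of "snd y" 0] y(1) B by simp
      finally show ?thesis using B norm_Pair_le[of "fst y" "snd y"] by simp
    qed
    then show ?thesis unfolding bounded_iff by blast
  qed
  have "compact K" using \<open>closed K\<close> \<open>bounded K\<close> by (simp add: compact_eq_bounded_closed)
  moreover have "g n \<in> K" for n
  proof -
    have "height (g n) \<le> height x * exp (\<delta> x (g n))" by (rule height_le_exp_dist[OF x g(1)])
    also have "\<dots> \<le> height x * exp r" using g(2) hx by simp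
    finally have 1: "height (g n) \<le> height x * exp r" .
    have "height x \<le> height (g n) * exp (\<delta> (g n) x)" by (rule height_le_exp_dist[OF g(1) x])
    also have "\<dots> \<le> height (g n) * exp r" using g(2)[of n] height_pos[OF g(1)[of n]] by (simp add: commute)
    finally have 2: "height x * exp (- r) \<le> height (g n)" by (simp add: exp_minus field_simps)
    have "(1 - L) * norm (snd x - snd (g n)) \<le> height x * (exp (\<delta> x (g n)) - 1)"
      by (rule dist_displacement[OF x g(1)])
    also have "\<dots> \<le> height x * (exp r - 1)" using g(2) hx by simp
    finally have 3: "norm (snd x - snd (g n)) \<le> A" unfolding A_def using L by (simp add: field_simps)
    show ?thesis unfolding K_def using 1 2 3 by simp
  qed
  ultimately obtain l s where l: "l \<in> K" "strict_mono s" "(g \<circ> s) \<longlonglongrightarrow> l"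
    unfolding compact_def by blast
  have l\<Omega>: "l \<in> \<Omega>" using l(1) hx unfolding K_def mem_iff_height by (auto intro: less_le_trans[rotated])
  have lim: "limitin mtopology (g \<circ> s) l sequentially" by (rule limitin_dist[OF l(3) _ l\<Omega>]) (simp add: g)
  have "l \<in> mcball x r"
    by (rule limitin_closedin[OF lim closedin_mcball]) (use g x in simp_all)
  then show "\<exists>l s. l \<in> mcball x r \<and> strict_mono s \<and> limitin mtopology (g \<circ> s) l sequentially"
    using l lim by blast
qed

text \<open>Halving chains of length close to \<open>\<delta> x y\<close> gives approximate
  midpoints, which accumulate at an exact one in a compact ball.\<close>

lemma midpoint_exists:
  assumes x: "x \<in> \<Omega>" and y: "y \<in> \<Omega>"
  shows "\<exists>z\<in>\<Omega>. \<delta> x z = \<delta> x y / 2 \<and> \<delta> z y = \<delta> x y / 2"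
proof -
  obtain l0 where l0: "null_chain \<Omega> x y l0" using null_chain_exists[OF x y] .
  have "\<exists>z. z \<in> \<Omega> \<and> \<delta> x z \<le> \<delta> x y / 2 + e \<and> \<delta> z y \<le> \<delta> x y / 2 + e" if e: "0 < e" for e
  proof -
    have "0 < 2 * e" using e by simp
    then obtain l where l: "null_chain \<Omega> x y l" "l < \<delta> x y + 2 * e" by (rule markowitz_dist_approx[OF l0])
    obtain z where z: "null_chain \<Omega> x z (l / 2)" "null_chain \<Omega> z y (l - l / 2)"
      using null_chain_split[OF l(1), of "l / 2"] null_chain_nonneg[OF l(1)] by auto
    show ?thesis
      using markowitz_dist_le[OF z(1)] markowitz_dist_le[OF z(2)] null_chain_mem[OF z(1)] l(2)
      by (intro exI[of _ z]) auto
  qed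
  then have "\<exists>z. z \<in> \<Omega> \<and> \<delta> x z \<le> \<delta> x y / 2 + inverse (Suc n) \<and> \<delta> z y \<le> \<delta> x y / 2 + inverse (Suc n)" for n
    by simp
  then obtain g where g: "\<And>n. g n \<in> \<Omega>" "\<And>n. \<delta> x (g n) \<le> \<delta> x y / 2 + inverse (Suc n)"
    "\<And>n. \<delta> (g n) y \<le> \<delta> x y / 2 + inverse (Suc n)" by metis
  have "inverse (real (Suc n)) \<le> 1" for n by (simp add: field_simps)
  then have "\<delta> x (g n) \<le> \<delta> x y / 2 + 1" for n using g(2) by (meson add_left_mono order_trans)
  then have "range g \<subseteq> mcball x (\<delta> x y / 2 + 1)" using x g(1) by auto
  then obtain z s where z: "z \<in> mcball x (\<delta> x y / 2 + 1)" "strict_mono s" "limitin mtopology (g \<circ> s) z sequentially"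
    using compactin_mcball[OF x] unfolding compactin_sequentially by meson
  have z\<Omega>: "z \<in> \<Omega>" using z by simp
  have dz: "(\<lambda>n. \<delta> (g (s n)) z) \<longlonglongrightarrow> 0" using z(3) unfolding limitin_metric_dist_null by simp
  have "(\<lambda>n. inverse (real (Suc n))) \<longlonglongrightarrow> 0" by (rule LIMSEQ_inverse_real_of_nat)
  then have inv: "(\<lambda>n. inverse (real (Suc (s n)))) \<longlonglongrightarrow> 0"
    using LIMSEQ_subseq_LIMSEQ[OF _ z(2)] by (auto simp: o_def)
  have lim: "(\<lambda>n. \<delta> x y / 2 + inverse (real (Suc (s n))) + \<delta> (g (s n)) z) \<longlonglongrightarrow> \<delta> x y / 2 + 0 + 0"
    by (intro tendsto_add tendsto_const inv dz)
  have "\<delta> x z \<le> \<delta> x y / 2 + inverse (real (Suc (s n))) + \<delta> (g (s n)) z" for n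
    using dist_triangle[OF x g(1) z\<Omega>, of "s n"] g(2)[of "s n"] by linarith
  then have 1: "\<delta> x z \<le> \<delta> x y / 2" using LIMSEQ_le_const[OF lim, of "\<delta> x z"] by auto
  have "\<delta> z y \<le> \<delta> x y / 2 + inverse (real (Suc (s n))) + \<delta> (g (s n)) z" for n
    using dist_triangle[OF z\<Omega> g(1) y, of "s n"] g(3)[of "s n"] commute[of z "g (s n)"] by linarith
  then have 2: "\<delta> z y \<le> \<delta> x y / 2" using LIMSEQ_le_const[OF lim, of "\<delta> z y"] by auto
  show ?thesis using 1 2 dist_triangle[OF x z\<Omega> y] z\<Omega> by (intro bexI[of _ z]) auto
qed

lemma proper_dist: "proper_metric_space \<Omega> \<delta>"
  unfolding proper_metric_space_def using Metric_space_dist compactin_mcball by blast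

lemma geodesic_dist: "geodesic_metric_space \<Omega> \<delta>"
  unfolding geodesic_metric_space_def
  using Metric_space_dist midpoints_imp_geodesic[OF compactin_mcball midpoint_exists] by blast

text \<open>The distance agrees up to an additive constant with
  \<open>2 ln (spread x y) - ln (height x) - ln (height y)\<close>, as in the upper half-space model.\<close>

definition spread :: "'a minkowski \<Rightarrow> 'a minkowski \<Rightarrow> real" where
  "spread x y = norm (snd x - snd y) + height x + height y"

lemma spread_commute: "spread x y = spread y x"
  unfolding spread_def by (simp add: norm_minus_commute)

lemma spread_pos: "x \<in> \<Omega> \<Longrightarrow> y \<in> \<Omega> \<Longrightarrow> 0 < spread x y"
  unfolding spread_def using height_pos[of x] height_pos[of y] norm_ge_zero[of "snd x - snd y"] by linarith

lemma spread_triangle: "z \<in> \<Omega> \<Longrightarrow> spread x y \<le> spread x z + spread z y"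
  unfolding spread_def using height_pos[of z] norm_triangle_ineq[of "snd x - snd z" "snd z - snd y"] by simp

text \<open>Both points go to \<open>join_pt x y\<close>. From each of them, the first null leg
  costs the logarithm of spread over height and the second one a constant depending only on
  \<open>L\<close>.\<close>

lemma dist_le_spread:
  assumes x: "x \<in> \<Omega>" and y: "y \<in> \<Omega>"
  shows "\<delta> x y \<le> 2 * ln (spread x y) - ln (height x) - ln (height y) + 2 * (ln 5 + ln (1 + 2 / (1 - L)))"
proof -
  define D where "D = \<bar>fst x - fst y\<bar> + norm (snd x - snd y)"
  have "fst x - fst y = height x - height y + (f (snd x) - f (snd y))" unfolding height_def by simp
  then have "\<bar>fst x - fst y\<bar> \<le> height x + height y + norm (snd x - snd y)"
    using lip[of "snd x" "snd y"] height_pos[OF x] height_pos[OF y] unfolding abs_le_iff by linarith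
  then have D: "D \<le> 2 * spread x y"
    unfolding D_def spread_def distrib_left using height_pos[OF x] height_pos[OF y] norm_ge_zero[of "snd x - snd y"]
    by (simp only: mult_2)
  obtain S T Q where z: "join_pt x y = x + (S, 0)" "join_pt x y = y + (T, Q)" "0 \<le> S" "norm Q \<le> T"
    "S \<le> D" "T \<le> D"
    unfolding D_def by (rule join_pt_diff)
  have *: "\<delta> w (w + (S, Q)) \<le> ln (spread x y) - ln (height w) + (ln 5 + ln (1 + 2 / (1 - L)))"
    if w: "w \<in> \<Omega>" "norm Q \<le> S" "S \<le> D" "height w \<le> spread x y" for w S and Q :: "(real, 'a) vec"
  proof -
    have hw: "0 < height w" using height_pos[OF w(1)] .
    obtain a b l where l: "0 \<le> b" "b \<le> a" "a \<le> S" "null_chain \<Omega> w (w + (S, Q)) l"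
      "l \<le> ln (1 + 2 * a / height w) + ln (1 + 2 * b / (height w + (1 - L) * a))"
      using null_chain_causal[OF w(1,2), of L] lipL L by auto
    \<comment> \<open>The factor 5 is 1 from \<open>height w \<le> spread x y\<close> plus 4 from
      \<open>2 * a \<le> 2 * D \<le> 4 * spread x y\<close>.\<close>
    have "1 + 2 * a / height w = (height w + 2 * a) / height w" using hw by (simp add: add_divide_distrib)
    also have "\<dots> \<le> 5 * spread x y / height w"
      using l w D hw by (intro divide_right_mono) auto
    finally have "1 + 2 * a / height w \<le> 5 * spread x y / height w" .
    moreover have "0 < 1 + 2 * a / height w" using l hw by (simp add: add_pos_nonneg)
    ultimately have "ln (1 + 2 * a / height w) \<le> ln (5 * spread x y / height w)" by (intro ln_mono) auto
    also have "\<dots> = ln 5 + ln (spread x y) - ln (height w)"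
      using spread_pos[OF x y] hw by (simp add: ln_div ln_mult)
    finally have 1: "ln (1 + 2 * a / height w) \<le> ln 5 + ln (spread x y) - ln (height w)" .
    have den: "0 < height w + (1 - L) * a" using hw l L by (intro add_pos_nonneg) auto
    have "2 * b * (1 - L) \<le> 2 * a * (1 - L)" using l L by (intro mult_right_mono) auto
    then have "2 * b / (height w + (1 - L) * a) \<le> 2 / (1 - L)"
      using den L hw by (simp add: field_simps)
    moreover have "0 < 1 + 2 * b / (height w + (1 - L) * a)" using den l by (simp add: add_pos_nonneg)
    ultimately have "ln (1 + 2 * b / (height w + (1 - L) * a)) \<le> ln (1 + 2 / (1 - L))"
      by (intro ln_mono) auto
    then show ?thesis using 1 l markowitz_dist_le[OF l(4)] by linarith
  qed
  have "join_pt x y \<in> \<Omega>" unfolding z(1) by (rule add_causal_mem[OF x]) (use z in simp)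
  then have "\<delta> x y \<le> \<delta> x (join_pt x y) + \<delta> y (join_pt x y)"
    using triangle'[OF x _ y, of "join_pt x y"] by simp
  moreover have "\<delta> x (join_pt x y) \<le> ln (spread x y) - ln (height x) + (ln 5 + ln (1 + 2 / (1 - L)))"
    unfolding z(1) by (rule *[OF x]) (use z height_pos[OF y] in \<open>auto simp: spread_def\<close>)
  moreover have "\<delta> y (join_pt x y) \<le> ln (spread x y) - ln (height y) + (ln 5 + ln (1 + 2 / (1 - L)))"
    unfolding z(2) by (rule *[OF y]) (use z height_pos[OF x] in \<open>auto simp: spread_def\<close>)
  ultimately show ?thesis by (simp add: algebra_simps)
qed

text \<open>The point \<open>z\<close> below splits a geodesic so that the two displacement bounds balance.\<close>

lemma dist_ge_spread:
  assumes x: "x \<in> \<Omega>" and y: "y \<in> \<Omega>"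
  shows "2 * ln (spread x y) - ln (height x) - ln (height y) - 2 * ln (2 / (1 - L)) \<le> \<delta> x y"
proof -
  \<comment> \<open>Chosen so that \<open>height x * exp a\<close> and
    \<open>height y * exp (\<delta> x y - a)\<close> have a common value \<open>E\<close>;
    \<open>ln_height_le_dist\<close> puts \<open>a\<close> between 0 and
    \<open>\<delta> x y\<close>.\<close>
  define a where "a = (\<delta> x y + ln (height y) - ln (height x)) / 2"
  have hx: "0 < height x" and hy: "0 < height y" using height_pos x y by auto
  have a: "0 \<le> a" "a \<le> \<delta> x y" unfolding a_def using ln_height_le_dist[OF x y] by (auto simp: abs_le_iff)
  obtain S where S: "geodesic_segment \<Omega> \<delta> x y S" using geodesic_dist x y unfolding geodesic_metric_space_def by blast
  obtain z where z: "z \<in> S" "\<delta> x z = a" "\<delta> z y = \<delta> x y - a"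
    using geodesic_segment_point[OF S a] by blast
  have z\<Omega>: "z \<in> \<Omega>" using geodesic_segment_mem[OF S z(1)] by simp
  define E where "E = exp ((ln (height x) + ln (height y) + \<delta> x y) / 2)"
  have "height x * exp a = exp (ln (height x) + a)" "height y * exp (\<delta> x y - a) = exp (ln (height y) + (\<delta> x y - a))"
    using hx hy by (simp_all only: exp_add exp_ln)
  moreover have "ln (height x) + a = (ln (height x) + ln (height y) + \<delta> x y) / 2"
    "ln (height y) + (\<delta> x y - a) = (ln (height x) + ln (height y) + \<delta> x y) / 2"
    unfolding a_def by (simp_all add: field_simps)
  ultimately have E: "height x * exp a = E" "height y * exp (\<delta> x y - a) = E" unfolding E_def by simp_all
  have 1: "(1 - L) * norm (snd x - snd z) \<le> E - height x"
    using dist_displacement[OF x z\<Omega>] z(2) E(1) by (simp add: algebra_simps)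
  have "height y * exp (\<delta> y z) = E" using E(2) unfolding z(3)[symmetric] commute[of z y] .
  then have 2: "(1 - L) * norm (snd y - snd z) \<le> E - height y"
    using dist_displacement[OF y z\<Omega>] unfolding right_diff_distrib by simp
  have "norm (snd x - snd y) \<le> norm (snd x - snd z) + norm (snd y - snd z)"
    using norm_triangle_ineq4[of "snd x - snd z" "snd y - snd z"] by (simp only: diff_diff_eq2 diff_add_cancel)
  then have "(1 - L) * norm (snd x - snd y) \<le> (1 - L) * (norm (snd x - snd z) + norm (snd y - snd z))"
    using L by (intro mult_left_mono) auto
  moreover have "(1 - L) * (height x + height y) \<le> 1 * (height x + height y)"
    using L hx hy by (intro mult_right_mono) auto
  ultimately have "(1 - L) * spread x y \<le> 2 * E" using 1 2 unfolding spread_def by (simp add: algebra_simps)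
  then have "spread x y \<le> 2 / (1 - L) * E" using L by (simp add: field_simps)
  then have "ln (spread x y) \<le> ln (2 / (1 - L) * E)" using spread_pos[OF x y] by (intro ln_mono) auto
  also have "\<dots> = ln (2 / (1 - L)) + ln E" using L unfolding E_def by (intro ln_mult_pos) auto
  finally have "ln (spread x y) \<le> ln (2 / (1 - L)) + (ln (height x) + ln (height y) + \<delta> x y) / 2"
    unfolding E_def by simp
  then show ?thesis by (simp add: field_simps)
qed

text \<open>Some mixed spread is at most the two that share an argument with it. By the triangle
  inequality each factor on the left is then at most twice a factor of the product not containing
  that spread.\<close>

lemma spread_four_point:
  assumes "x \<in> \<Omega>" "y \<in> \<Omega>" "z \<in> \<Omega>" "w \<in> \<Omega>"
  shows "spread x y * spread z w \<le> 4 * (spread x z * spread y w) \<or>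
    spread x y * spread z w \<le> 4 * (spread x w * spread y z)"
proof -
  note p = spread_pos[OF assms(1,2)] spread_pos[OF assms(3,4)]
  have mult: "a * b \<le> 4 * (c * d)" if "a \<le> 2 * c" "b \<le> 2 * d" "0 < b" "0 < a" for a b c d :: real
    using mult_mono[OF that(1,2)] that by simp
  have t: "spread x y \<le> spread x z + spread y z" "spread x y \<le> spread x w + spread y w"
    "spread z w \<le> spread x z + spread x w" "spread z w \<le> spread y z + spread y w"
    using spread_triangle[OF assms(3), of x y] spread_triangle[OF assms(4), of x y]
      spread_triangle[OF assms(1), of z w] spread_triangle[OF assms(2), of z w]
    by (simp_all add: spread_commute)
  consider "spread x z \<le> spread x w" "spread x z \<le> spread y z"
    | "spread y w \<le> spread x w" "spread y w \<le> spread y z"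
    | "spread x w \<le> spread x z" "spread x w \<le> spread y w"
    | "spread y z \<le> spread x z" "spread y z \<le> spread y w" by linarith
  then show ?thesis
  proof cases
    case 1
    then have "spread x y \<le> 2 * spread y z" "spread z w \<le> 2 * spread x w" using t by linarith+
    from mult[OF this p(2,1)] show ?thesis by (simp add: mult.commute)
  next
    case 2
    then have "spread x y \<le> 2 * spread x w" "spread z w \<le> 2 * spread y z" using t by linarith+
    from mult[OF this p(2,1)] show ?thesis by simp
  next
    case 3
    then have "spread x y \<le> 2 * spread y w" "spread z w \<le> 2 * spread x z" using t by linarith+
    from mult[OF this p(2,1)] show ?thesis by (simp add: mult.commute)
  next
    case 4
    then have "spread x y \<le> 2 * spread x z" "spread z w \<le> 2 * spread y w" using t by linarith+
    from mult[OF this p(2,1)] show ?thesis by simp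
  qed
qed

text \<open>In each of the three sums every point occurs once, so the terms
  \<open>ln (height _)\<close> cancel and only the inequality for products of spreads
  remains.\<close>

lemma dist_four_point:
  obtains C where "\<And>x y z w. \<lbrakk>x \<in> \<Omega>; y \<in> \<Omega>; z \<in> \<Omega>; w \<in> \<Omega>\<rbrakk> \<Longrightarrow>
    \<delta> x y + \<delta> z w \<le> max (\<delta> x z + \<delta> y w) (\<delta> x w + \<delta> y z) + C"
proof
  fix x y z w assume m: "x \<in> \<Omega>" "y \<in> \<Omega>" "z \<in> \<Omega>" "w \<in> \<Omega>"
  define U where "U = 2 * (ln 5 + ln (1 + 2 / (1 - L)))"
  define V where "V = 2 * ln (2 / (1 - L))"
  note up = dist_le_spread[folded U_def]
  note lo = dist_ge_spread[folded V_def]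
  have *: "ln (spread x y) + ln (spread z w) \<le> ln 4 + (ln A + ln B)"
    if "spread x y * spread z w \<le> 4 * (A * B)" "0 < A" "0 < B" for A B
  proof -
    have "ln (spread x y * spread z w) \<le> ln (4 * (A * B))"
      using that spread_pos m by (intro ln_mono) auto
    then show ?thesis using that spread_pos[OF m(1,2)] spread_pos[OF m(3,4)] by (simp add: ln_mult_pos)
  qed
  \<comment> \<open>Two upper and two lower estimates give \<open>2 * U + 2 * V\<close>; the factor
    4 of the spreads enters doubled.\<close>
  show "\<delta> x y + \<delta> z w \<le> max (\<delta> x z + \<delta> y w) (\<delta> x w + \<delta> y z) + (2 * U + 2 * V + 2 * ln 4)"
    using spread_four_point[OF m]
  proof
    assume "spread x y * spread z w \<le> 4 * (spread x z * spread y w)"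
    from *[OF this spread_pos[OF m(1,3)] spread_pos[OF m(2,4)]] show ?thesis
      using up[OF m(1,2)] up[OF m(3,4)] lo[OF m(1,3)] lo[OF m(2,4)] by linarith
  next
    assume "spread x y * spread z w \<le> 4 * (spread x w * spread y z)"
    from *[OF this spread_pos[OF m(1,4)] spread_pos[OF m(2,3)]] show ?thesis
      using up[OF m(1,2)] up[OF m(3,4)] lo[OF m(1,4)] lo[OF m(2,3)] by linarith
  qed
qed

lemma gromov_hyperbolic_dist: "gromov_hyperbolic \<Omega> \<delta>"
proof -
  obtain C where C: "\<And>x y z w. \<lbrakk>x \<in> \<Omega>; y \<in> \<Omega>; z \<in> \<Omega>; w \<in> \<Omega>\<rbrakk> \<Longrightarrow>
    \<delta> x y + \<delta> z w \<le> max (\<delta> x z + \<delta> y w) (\<delta> x w + \<delta> y z) + C"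
    using dist_four_point by metis
  define r where "r = max 0 (2 * C) + 1"
  have r: "0 < r" "2 * C < r" unfolding r_def by auto
  have "S \<subseteq> nbhd \<Omega> \<delta> r (T \<union> U)"
    if seg: "geodesic_segment \<Omega> \<delta> x y S" "geodesic_segment \<Omega> \<delta> y z T" "geodesic_segment \<Omega> \<delta> z x U" for x y z S T U
  proof
    fix p assume p: "p \<in> S"
    obtain q where "q \<in> T \<union> U" "\<delta> p q \<le> 2 * C" using four_point_imp_thin[OF C seg p] by auto
    then show "p \<in> nbhd \<Omega> \<delta> r (T \<union> U)"
      using r geodesic_segment_mem(1)[OF that(1) p] unfolding nbhd_def by force
  qed
  then show ?thesis
    unfolding gromov_hyperbolic_def using proper_dist geodesic_dist r(1) by (intro conjI exI[of _ r]) blast+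
qed

end

section \<open>Asymptotically lightlike boundary\<close>

context epigraph_domain
begin

lemma norm_subgradient_le_1:
  assumes "\<And>q. f p + \<xi> \<bullet> (q - p) \<le> f q"
  shows "norm \<xi> \<le> 1"
proof -
  have "f p + \<xi> \<bullet> \<xi> \<le> f (p + \<xi>)" using assms[of "p + \<xi>"] by simp
  then have "norm \<xi> * norm \<xi> \<le> norm \<xi> * 1"
    using lip[of "p + \<xi>" p] by (simp add: dot_square_norm power2_eq_square)
  then show ?thesis by (cases "\<xi> = 0") auto
qed

lemma inner_subgradient_bounds:
  assumes "\<And>q. f p + \<xi> \<bullet> (q - p) \<le> f q" "norm u = 1"
  shows "- 1 \<le> \<xi> \<bullet> u" "\<xi> \<bullet> u \<le> 1"
  using Cauchy_Schwarz_ineq2[of \<xi> u] norm_subgradient_le_1[OF assms(1)] assms(2) by (auto simp: abs_le_iff)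

text \<open>A secant of slope above \<open>1 - e\<close> forces the subgradient at its upper end to
  have such a slope, and convexity keeps it all along the ray beyond. Moving the ray to the origin
  changes values by a bounded amount. Compactness of the sphere gives one \<open>u\<close> for all
  \<open>e\<close>.\<close>

lemma asymptotic_direction:
  assumes steep: "\<And>L. 0 \<le> L \<Longrightarrow> L < 1 \<Longrightarrow> \<exists>p q. L * norm (p - q) < \<bar>f p - f q\<bar>"
  obtains u where "norm u = 1" "\<And>e. 0 < e \<Longrightarrow> \<exists>C. \<forall>s\<ge>0. (1 - e) * s - C \<le> f (s *\<^sub>R u)"
proof -
  have "\<exists>u C. norm u = 1 \<and> (\<forall>s\<ge>0. (1 - e) * s - C \<le> f (s *\<^sub>R u))" if e: "0 < e" "e \<le> 1" for e
  proof -
    obtain p q where pq: "(1 - e) * norm (q - p) < f q - f p"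
    proof -
      obtain p q where *: "(1 - e) * norm (p - q) < \<bar>f p - f q\<bar>" using steep[of "1 - e"] e by auto
      show ?thesis
        using that[of p q] that[of q p] * by (cases "f p \<le> f q") (auto simp: norm_minus_commute abs_if split: if_splits)
    qed
    have "q \<noteq> p" using pq by auto
    define u where "u = (q - p) /\<^sub>R norm (q - p)"
    have u: "norm u = 1" "q - p = norm (q - p) *\<^sub>R u" using \<open>q \<noteq> p\<close> unfolding u_def by simp_all
    obtain \<xi> where xi: "\<And>z. f q + \<xi> \<bullet> (z - q) \<le> f z" using subgrad by blast
    have "\<xi> \<bullet> (p - q) = - (norm (q - p) * (\<xi> \<bullet> u))"
      using u(2) by (metis inner_minus_right inner_scaleR_right minus_diff_eq)
    then have "(1 - e) * norm (q - p) < (\<xi> \<bullet> u) * norm (q - p)"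
      using xi[of p] pq by (simp add: mult.commute)
    then have slope: "1 - e < \<xi> \<bullet> u" by (rule mult_right_less_imp_less) simp
    have "(1 - e) * s - (norm q - f q) \<le> f (s *\<^sub>R u)" if "0 \<le> s" for s
    proof -
      have "(1 - e) * s \<le> s * (\<xi> \<bullet> u)" using slope that by (metis less_imp_le mult.commute mult_left_mono)
      moreover have "f q + s * (\<xi> \<bullet> u) \<le> f (q + s *\<^sub>R u)" using xi[of "q + s *\<^sub>R u"] by simp
      moreover have "f (q + s *\<^sub>R u) - f (s *\<^sub>R u) \<le> norm q" using lip[of "q + s *\<^sub>R u" "s *\<^sub>R u"] by simp
      ultimately show ?thesis by linarith
    qed
    then show ?thesis using u(1) by blast
  qed
  then have "\<exists>u C. norm u = 1 \<and> (\<forall>s\<ge>0. (1 - inverse (real (Suc n))) * s - C \<le> f (s *\<^sub>R u))" for n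
    by (simp add: inverse_le_1_iff)
  then obtain g c where g: "\<And>n. norm (g n) = 1"
    "\<And>n s. 0 \<le> s \<Longrightarrow> (1 - inverse (real (Suc n))) * s - c n \<le> f (s *\<^sub>R g n)" by metis
  have "g n \<in> sphere 0 1" for n using g(1) by simp
  then obtain u t where u: "u \<in> sphere 0 1" "strict_mono t" "(g \<circ> t) \<longlonglongrightarrow> u"
    using compact_sphere[of 0 1] unfolding compact_def by blast
  \<comment> \<open>Replacing \<open>g (t n)\<close> by \<open>u\<close> costs
    \<open>s * norm (g (t n) - u)\<close>, a loss of slope which \<open>e\<close> absorbs for a
    suitable \<open>n\<close>.\<close>
  have "\<exists>C. \<forall>s\<ge>0. (1 - e) * s - C \<le> f (s *\<^sub>R u)" if e: "0 < e" for e
  proof -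
    have "(\<lambda>n. norm (g (t n) - u)) \<longlonglongrightarrow> 0" using tendsto_norm_zero[OF LIM_zero[OF u(3)]] by (simp add: o_def)
    moreover have "(\<lambda>n. inverse (real (Suc (t n)))) \<longlonglongrightarrow> 0"
      using LIMSEQ_subseq_LIMSEQ[OF LIMSEQ_inverse_real_of_nat u(2)] by (simp add: o_def)
    ultimately have "(\<lambda>n. norm (g (t n) - u) + inverse (real (Suc (t n)))) \<longlonglongrightarrow> 0 + 0" by (rule tendsto_add)
    then have "\<forall>\<^sub>F n in sequentially. norm (g (t n) - u) + inverse (real (Suc (t n))) < e"
      using e by (intro order_tendstoD(2)[of _ 0]) auto
    then obtain n where n: "norm (g (t n) - u) + inverse (real (Suc (t n))) < e"
      using eventually_happens'[OF sequentially_bot] by blast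
    have "(1 - e) * s - c (t n) \<le> f (s *\<^sub>R u)" if s: "0 \<le> s" for s
    proof -
      have "f (s *\<^sub>R g (t n)) - f (s *\<^sub>R u) \<le> norm (s *\<^sub>R (g (t n) - u))"
        using lip[of "s *\<^sub>R g (t n)" "s *\<^sub>R u"] by (simp add: scaleR_diff_right)
      moreover have "norm (s *\<^sub>R (g (t n) - u)) = s * norm (g (t n) - u)" using s by simp
      moreover have "s * norm (g (t n) - u) + s * inverse (real (Suc (t n))) \<le> s * e"
        using n s by (simp add: distrib_left[symmetric] mult_left_mono)
      moreover have "s - s * inverse (real (Suc (t n))) - c (t n) \<le> f (s *\<^sub>R g (t n))"
        using g(2)[OF s, of "t n"] by (simp add: algebra_simps)
      moreover have "(1 - e) * s = s - s * e" by (simp add: algebra_simps)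
      ultimately show ?thesis by linarith
    qed
    then show ?thesis by blast
  qed
  then show ?thesis using u(1) that[of u] by simp
qed

text \<open>The null line meets \<open>\<Omega>\<close> in the half-line issuing from a boundary
  point \<open>b\<close>. Its ray length bounds \<open>\<delta>\<close> from above; the half-space
  supporting over \<open>b\<close>, whose functional is \<open>s * m\<close> along the line, gives
  the same bound from below.\<close>

lemma null_line_geodesic:
  assumes w: "w \<in> \<Omega>" and u: "norm u = 1" and leaves: "\<exists>s. w + s *\<^sub>R (1, u) \<notin> \<Omega>"
    and ab: "w - a *\<^sub>R (1, u) \<in> \<Omega>" "0 \<le> a" "0 \<le> c"
  shows "\<exists>S. w \<in> S \<and> geodesic_segment \<Omega> \<delta> (w - a *\<^sub>R (1, u)) (w + c *\<^sub>R (1, u)) S"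
proof -
  define v where "v = (1 :: real, u)"
  have up: "x + s *\<^sub>R v \<in> \<Omega>" if "x \<in> \<Omega>" "0 \<le> s" for x s
    by (rule add_causal_mem[OF that(1)]) (use that u in \<open>simp add: v_def\<close>)
  obtain s0 where s0: "w + s0 *\<^sub>R v \<notin> \<Omega>" using leaves v_def by blast
  have "s0 < 0" using up[OF w, of s0] s0 by (cases "0 \<le> s0") auto
  have cont: "continuous_on A (\<lambda>s. height (w + s *\<^sub>R v))" for A
    by (rule continuous_on_compose2[OF continuous_height]) (auto intro!: continuous_intros)
  obtain k where k: "height (w + k *\<^sub>R v) = 0" "k \<le> 0"
    using IVT'[of "\<lambda>s. height (w + s *\<^sub>R v)" s0 0 0] s0 w \<open>s0 < 0\<close> cont unfolding mem_iff_height by auto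
  define b where "b = w + k *\<^sub>R v"
  have b: "height b = 0" using k b_def by simp
  have wb: "w = b + (- k) *\<^sub>R v" unfolding b_def by simp
  have "k \<noteq> 0" using k w unfolding mem_iff_height by auto
  obtain \<xi> e where sup: "\<And>z. height z \<le> half_space_fun \<xi> e z" "\<And>z. snd z = snd b \<Longrightarrow> half_space_fun \<xi> e z = height z"
    using support_half_space[of "snd b"] by metis
  have pos: "0 < half_space_fun \<xi> e z" if "z \<in> \<Omega>" for z using sup(1)[of z] height_pos[OF that] by linarith
  define m where "m = 1 - \<xi> \<bullet> u"
  have \<phi>: "half_space_fun \<xi> e (b + s *\<^sub>R v) = s * m" for s
    unfolding half_space_fun_add using sup(2)[of b] b by (simp add: v_def m_def)
  have "0 < (- k) * m" using pos[OF w] \<phi>[of "- k"] wb by simp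
  then have m: "0 < m" using k \<open>k \<noteq> 0\<close> by (simp add: mult_less_0_iff)
  \<comment> \<open>Between \<open>b\<close> and \<open>w\<close> convexity enters through the
    subgradient at the intermediate point: if its slope along \<open>u\<close> is below 1 compare
    with \<open>b\<close>, otherwise with \<open>w\<close>.\<close>
  have mem: "b + s *\<^sub>R v \<in> \<Omega>" if s: "0 < s" for s
  proof (cases "- k \<le> s")
    case True
    then show ?thesis using up[OF w, of "s + k"] unfolding wb by (simp add: algebra_simps)
  next
    case False
    obtain \<zeta> where z: "\<And>q. f (snd b + s *\<^sub>R u) + \<zeta> \<bullet> (q - (snd b + s *\<^sub>R u)) \<le> f q" using subgrad by blast
    have "f (snd b + s *\<^sub>R u) - s * (\<zeta> \<bullet> u) \<le> f (snd b)" using z[of "snd b"] by simp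
    moreover have "f (snd b + s *\<^sub>R u) + (- k - s) * (\<zeta> \<bullet> u) \<le> f (snd w)"
    proof -
      have "snd w - (snd b + s *\<^sub>R u) = (- k - s) *\<^sub>R u" unfolding b_def by (simp add: v_def algebra_simps)
      then show ?thesis using z[of "snd w"] by (simp add: inner_scaleR_right)
    qed
    moreover have "f (snd w) < f (snd b) - k"
      using height_pos[OF w] b unfolding height_def b_def by (simp add: v_def)
    moreover have fb: "f (snd b) = fst b" using b unfolding height_def by simp
    ultimately have *: "f (snd b + s *\<^sub>R u) - s * (\<zeta> \<bullet> u) \<le> fst b"
      "f (snd b + s *\<^sub>R u) + (- k - s) * (\<zeta> \<bullet> u) < fst b - k" by simp_all
    have "f (snd b + s *\<^sub>R u) < fst b + s"
    proof (cases "\<zeta> \<bullet> u < 1")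
      case True
      then have "s * (\<zeta> \<bullet> u) < s * 1" using s by (intro mult_strict_left_mono) auto
      then show ?thesis using *(1) by linarith
    next
      case ge: False
      then have "(- k - s) * 1 \<le> (- k - s) * (\<zeta> \<bullet> u)" using False by (intro mult_left_mono) auto
      then have "f (snd b + s *\<^sub>R u) + (- k - s) < fst b - k"
        unfolding mult_1_right by (rule le_less_trans[OF add_left_mono *(2)])
      then show ?thesis by simp
    qed
    then show ?thesis unfolding epi by (simp add: v_def)
  qed
  have dist: "\<delta> (b + s *\<^sub>R v) (b + t *\<^sub>R v) = \<bar>ln s - ln t\<bar>" if st: "0 < s" "0 < t" for s t
  proof (rule order_antisym)
    have "null_step \<Omega> (b + s *\<^sub>R v) (b + t *\<^sub>R v) \<bar>ln s - ln t\<bar>"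
      by (rule null_step_ray) (use lightlike_unit[OF u] mem st v_def in auto)
    then show "\<delta> (b + s *\<^sub>R v) (b + t *\<^sub>R v) \<le> \<bar>ln s - ln t\<bar>" by (intro markowitz_dist_le null_chain.single)
    have "\<bar>ln (s * m) - ln (t * m)\<bar> \<le> \<delta> (b + s *\<^sub>R v) (b + t *\<^sub>R v)"
      using dist_ge_ln_half_space[OF mem[OF st(1)] mem[OF st(2)] pos] unfolding \<phi> .
    then show "\<bar>ln s - ln t\<bar> \<le> \<delta> (b + s *\<^sub>R v) (b + t *\<^sub>R v)" using st m by (simp add: ln_mult_pos)
  qed
  \<comment> \<open>Otherwise the boundary point \<open>b\<close> would lie in the future of a point
    of \<open>\<Omega>\<close>.\<close>
  have "a < - k"
  proof (rule ccontr)
    assume "\<not> a < - k"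
    then have "b \<in> \<Omega>" using up[OF ab(1), of "a + k"] unfolding b_def v_def[symmetric] by (simp add: algebra_simps)
    then show False using b unfolding mem_iff_height by simp
  qed
  define s1 s2 where "s1 = - k - a" and "s2 = c - k"
  have s12: "0 < s1" "s1 \<le> - k" "- k \<le> s2" "0 < s2" using \<open>a < - k\<close> ab k \<open>k \<noteq> 0\<close> unfolding s1_def s2_def by auto
  define \<gamma> where "\<gamma> t = b + exp (ln s1 + t) *\<^sub>R v" for t
  define l where "l = ln s2 - ln s1"
  have "geodesic_segment \<Omega> \<delta> (\<gamma> 0) (\<gamma> l) (\<gamma> ` {0..l})"
    unfolding geodesic_segment_def
  proof (intro exI[of _ l] exI[of _ \<gamma>] conjI ballI)
    show "0 \<le> l" unfolding l_def using s12 by simp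
    show "\<gamma> ` {0..l} \<subseteq> \<Omega>" unfolding \<gamma>_def using mem by auto
    show "\<delta> (\<gamma> s) (\<gamma> t) = \<bar>s - t\<bar>" for s t unfolding \<gamma>_def by (subst dist) auto
  qed auto
  moreover have "\<gamma> 0 = w - a *\<^sub>R (1, u)" "\<gamma> l = w + c *\<^sub>R (1, u)"
    unfolding \<gamma>_def l_def using s12 unfolding s1_def s2_def wb v_def[symmetric] by (simp_all add: algebra_simps)
  moreover have "w \<in> \<gamma> ` {0..l}"
  proof (rule image_eqI)
    show "w = \<gamma> (ln (- k) - ln s1)" unfolding \<gamma>_def using s12 wb by simp
    show "ln (- k) - ln s1 \<in> {0..l}" unfolding l_def using s12 by simp
  qed
  ultimately show ?thesis by (intro exI[of _ "\<gamma> ` {0..l}"]) simp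
qed

text \<open>Null coordinates \<open>U\<close>, \<open>V\<close> on the timelike plane through \<open>(f 0 + 1, 0)\<close> in the direction \<open>u\<close>.\<close>

definition plane_pt :: "(real, 'n) vec \<Rightarrow> real \<Rightarrow> real \<Rightarrow> 'n minkowski" where
  "plane_pt u U V = (f 0 + 1 + (U + V) / 2, ((V - U) / 2) *\<^sub>R u)"

lemma plane_pt_mem:
  assumes "norm u = 1" "0 \<le> U" "0 \<le> V"
  shows "plane_pt u U V \<in> \<Omega>"
proof -
  have "f (((V - U) / 2) *\<^sub>R u) - f 0 \<le> \<bar>(V - U) / 2\<bar>"
    using order_trans[OF abs_ge_self lip[of "((V - U) / 2) *\<^sub>R u" 0]] assms(1) by simp
  also have "\<dots> \<le> (U + V) / 2" using assms by (auto simp: abs_if field_simps)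
  finally have "f (((V - U) / 2) *\<^sub>R u) < f 0 + 1 + (U + V) / 2" by linarith
  then show ?thesis unfolding epi plane_pt_def by simp
qed

lemma half_space_plane_pt:
  "half_space_fun \<xi> e (plane_pt u U V) =
    half_space_fun \<xi> e (plane_pt u 0 0) + (1 + \<xi> \<bullet> u) / 2 * U + (1 - \<xi> \<bullet> u) / 2 * V"
  unfolding half_space_fun_def plane_pt_def by (simp add: field_simps)

text \<open>Change first \<open>U\<close>, then \<open>V\<close>, each along a null half-line; the
  halved direction vectors make the coordinate itself the ray parameter.\<close>

lemma dist_plane_pt_le:
  assumes u: "norm u = 1" and pos: "0 < U" "0 < U'" "0 < V" "0 < V'"
  shows "\<delta> (plane_pt u U V) (plane_pt u U' V') \<le> \<bar>ln U - ln U'\<bar> + \<bar>ln V - ln V'\<bar>"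
proof -
  have v: "lightlike (1 / 2, (1 / 2) *\<^sub>R u)" "lightlike (1 / 2, - (1 / 2) *\<^sub>R u)"
    using u unfolding lightlike_def mink_eps_def by (auto simp: dot_square_norm zero_prod_def power_divide)
  have U: "plane_pt u U V = plane_pt u 0 V + U *\<^sub>R (1 / 2, - (1 / 2) *\<^sub>R u)" for U V
    unfolding plane_pt_def by (simp add: prod_eq_iff add_divide_distrib diff_divide_distrib scaleR_diff_left)
  have V: "plane_pt u U V = plane_pt u U 0 + V *\<^sub>R (1 / 2, (1 / 2) *\<^sub>R u)" for U V
    unfolding plane_pt_def by (simp add: prod_eq_iff add_divide_distrib diff_divide_distrib scaleR_diff_left)
  have "plane_pt u 0 V + s *\<^sub>R (1 / 2, - (1 / 2) *\<^sub>R u) \<in> \<Omega>" if "0 < s" for s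
    unfolding U[symmetric] by (rule plane_pt_mem[OF u]) (use pos that in simp_all)
  from null_step_ray[OF v(2) this pos(1,2)]
  have "null_step \<Omega> (plane_pt u U V) (plane_pt u U' V) \<bar>ln U - ln U'\<bar>"
    unfolding U[symmetric] .
  moreover have "plane_pt u U' 0 + s *\<^sub>R (1 / 2, (1 / 2) *\<^sub>R u) \<in> \<Omega>" if "0 < s" for s
    unfolding V[symmetric] by (rule plane_pt_mem[OF u]) (use pos that in simp_all)
  from null_step_ray[OF v(1) this pos(3,4)]
  have "null_step \<Omega> (plane_pt u U' V) (plane_pt u U' V') \<bar>ln V - ln V'\<bar>"
    unfolding V[symmetric] .
  ultimately show ?thesis by (intro markowitz_dist_le null_chain.cons null_chain.single)
qed

lemma dist_plane_pt_ge:
  assumes u: "norm u = 1" and p: "0 \<le> U" "0 \<le> V" "0 \<le> U'" "0 \<le> V'"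
    and pos: "\<And>z. z \<in> \<Omega> \<Longrightarrow> 0 < half_space_fun \<xi> e z"
    and le: "q * half_space_fun \<xi> e (plane_pt u U V) \<le> half_space_fun \<xi> e (plane_pt u U' V')" and q: "0 < q"
  shows "ln q \<le> \<delta> (plane_pt u U V) (plane_pt u U' V')"
proof -
  let ?\<phi> = "half_space_fun \<xi> e"
  have m: "plane_pt u U V \<in> \<Omega>" "plane_pt u U' V' \<in> \<Omega>" using plane_pt_mem[OF u] p by auto
  have "ln (q * ?\<phi> (plane_pt u U V)) \<le> ln (?\<phi> (plane_pt u U' V'))"
    using pos[OF m(1)] q le by (intro ln_mono) auto
  then have "ln q \<le> ln (?\<phi> (plane_pt u U' V')) - ln (?\<phi> (plane_pt u U V))"
    using pos[OF m(1)] q by (simp add: ln_mult_pos)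
  also have "\<dots> \<le> \<bar>ln (?\<phi> (plane_pt u U V)) - ln (?\<phi> (plane_pt u U' V'))\<bar>" by simp
  also have "\<dots> \<le> \<delta> (plane_pt u U V) (plane_pt u U' V')" by (rule dist_ge_ln_half_space[OF m pos])
  finally show ?thesis .
qed

text \<open>The null line leaves \<open>\<Omega>\<close> at some \<open>s < 0\<close> with
  \<open>f (s *\<^sub>R u) \<ge> f 0 + 1 + s\<close>. Slope 1 along \<open>u\<close> of the
  subgradient there would give \<open>f 0 \<ge> f 0 + 1\<close>. The coefficient of \<open>V\<close>
  in the functional is therefore positive.\<close>

lemma plane_half_space_nonlightlike:
  assumes u: "norm u = 1" and leaves: "\<exists>s. plane_pt u 0 0 + s *\<^sub>R (1, u) \<notin> \<Omega>"
  obtains \<xi> e where "\<And>z. z \<in> \<Omega> \<Longrightarrow> 0 < half_space_fun \<xi> e z" "- 1 \<le> \<xi> \<bullet> u" "\<xi> \<bullet> u < 1"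
proof -
  obtain s where s: "f 0 + 1 + s \<le> f (s *\<^sub>R u)"
    using leaves unfolding epi plane_pt_def by (auto simp: not_less)
  have "s < 0" using s lip[of "s *\<^sub>R u" 0] u by (auto simp: abs_if split: if_splits)
  obtain \<xi> e where sup: "\<And>z. height z \<le> half_space_fun \<xi> e z"
    "\<And>q. f (s *\<^sub>R u) + \<xi> \<bullet> (q - s *\<^sub>R u) \<le> f q"
    using support_half_space[of "s *\<^sub>R u"] by metis
  have "f (s *\<^sub>R u) - s * (\<xi> \<bullet> u) \<le> f 0" using sup(2)[of 0] by simp
  then have "0 < (- s) * (1 - \<xi> \<bullet> u)" using s by (simp add: algebra_simps)
  then have "\<xi> \<bullet> u < 1" using \<open>s < 0\<close> by (simp add: mult_less_0_iff zero_less_mult_iff)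
  moreover have "0 < half_space_fun \<xi> e z" if "z \<in> \<Omega>" for z
    using sup(1)[of z] height_pos[OF that] by linarith
  ultimately show ?thesis using that inner_subgradient_bounds(1)[OF sup(2) u] by blast
qed

text \<open>By convexity the slope at \<open>s *\<^sub>R u\<close> is at least the mean slope from
  the origin, close to 1 for large \<open>s\<close>. The small coefficient of \<open>V\<close> lets
  the functional detect \<open>U\<close> even where \<open>V\<close> is much larger.\<close>

lemma plane_half_space_almost_lightlike:
  assumes u: "norm u = 1" and asym: "\<exists>C. \<forall>s\<ge>0. (1 - e) * s - C \<le> f (s *\<^sub>R u)" and e: "0 < e"
  obtains \<xi> c where "\<And>z. z \<in> \<Omega> \<Longrightarrow> 0 < half_space_fun \<xi> c z" "1 - 2 * e \<le> \<xi> \<bullet> u" "\<xi> \<bullet> u \<le> 1"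
proof -
  obtain C where C: "\<And>s. 0 \<le> s \<Longrightarrow> (1 - e) * s - C \<le> f (s *\<^sub>R u)" using asym by blast
  \<comment> \<open>Large enough for \<open>e * s\<close> to absorb both \<open>C\<close> and
    \<open>f 0\<close>.\<close>
  define s where "s = (\<bar>C\<bar> + \<bar>f 0\<bar> + 1) / e"
  have s: "0 < s" "e * s = \<bar>C\<bar> + \<bar>f 0\<bar> + 1" using e unfolding s_def by (auto simp: field_simps)
  obtain \<xi> c where sup: "\<And>z. height z \<le> half_space_fun \<xi> c z"
    "\<And>q. f (s *\<^sub>R u) + \<xi> \<bullet> (q - s *\<^sub>R u) \<le> f q"
    using support_half_space[of "s *\<^sub>R u"] by metis
  have "f (s *\<^sub>R u) - s * (\<xi> \<bullet> u) \<le> f 0" using sup(2)[of 0] by simp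
  moreover have "(1 - e) * s - C \<le> f (s *\<^sub>R u)" using C s by simp
  moreover have "C + f 0 \<le> e * s" unfolding s(2) using abs_ge_self[of C] abs_ge_self[of "f 0"] by linarith
  ultimately have "s * (1 - 2 * e) \<le> s * (\<xi> \<bullet> u)" by (simp add: algebra_simps)
  then have "1 - 2 * e \<le> \<xi> \<bullet> u" using s(1) by simp
  moreover have "0 < half_space_fun \<xi> c z" if "z \<in> \<Omega>" for z
    using sup(1)[of z] height_pos[OF that] by linarith
  ultimately show ?thesis using that inner_subgradient_bounds(2)[OF sup(2) u] by blast
qed

text \<open>In the logarithmic coordinates \<open>ln (U / r)\<close>, \<open>ln (V / r)\<close> the detour runs along three sides of a
  rectangle whose fourth side is the null geodesic through the point \<open>(0, R)\<close>; it has length \<open>4 R\<close>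
  and stays at distance about \<open>R\<close> from that point.\<close>

definition detour_U :: "nat \<Rightarrow> nat \<Rightarrow> real" where
  "detour_U R i = - min (real i) (min (real R) (4 * real R - real i))"

definition detour_V :: "nat \<Rightarrow> nat \<Rightarrow> real" where
  "detour_V R i = max 0 (min (real i - real R) (2 * real R))"

text \<open>On the first and third side \<open>V\<close> differs from that of the central point by
  the factor \<open>exp R\<close>, which the functional with \<open>B > 0\<close> detects. On the
  second side \<open>U\<close> does, detected by an almost lightlike functional. \<open>C\<close>
  depends on \<open>B\<close> only, not on \<open>R\<close>.\<close>

lemma detour_far:
  assumes u: "norm u = 1" and leaves: "\<exists>s. plane_pt u 0 0 + s *\<^sub>R (1, u) \<notin> \<Omega>"
    and asym: "\<And>e. 0 < e \<Longrightarrow> \<exists>C. \<forall>s\<ge>0. (1 - e) * s - C \<le> f (s *\<^sub>R u)"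
  obtains C where "\<And>R. \<exists>r>0. \<forall>i\<le>4 * R.
      real R - C \<le> \<delta> (plane_pt u r (r * exp R)) (plane_pt u (r * exp (detour_U R i)) (r * exp (detour_V R i)))"
proof -
  obtain \<xi> e where s1: "\<And>z. z \<in> \<Omega> \<Longrightarrow> 0 < half_space_fun \<xi> e z" "- 1 \<le> \<xi> \<bullet> u" "\<xi> \<bullet> u < 1"
    using plane_half_space_nonlightlike[OF u leaves] by metis
  define A B where "A = (1 + \<xi> \<bullet> u) / 2" and "B = (1 - \<xi> \<bullet> u) / 2"
  have AB: "0 \<le> A" "0 < B" "A + B = 1" using s1 unfolding A_def B_def by (auto simp: field_simps)
  define c where "c = half_space_fun \<xi> e (plane_pt u 0 0)"
  have c: "0 < c" unfolding c_def using s1(1) plane_pt_mem[OF u] by simp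
  have h1: "half_space_fun \<xi> e (plane_pt u U V) = c + A * U + B * V" for U V
    unfolding c_def A_def B_def by (rule half_space_plane_pt)
  define C where "C = ln 3 - ln (B / 2)"
  have ln3: "0 \<le> ln (3 :: real)" by simp
  have lnB: "ln (B / 2) \<le> 0" using AB by (simp add: ln_le_zero_iff)
  have "\<exists>r>0. \<forall>i\<le>4 * R. real R - C \<le>
      \<delta> (plane_pt u r (r * exp R)) (plane_pt u (r * exp (detour_U R i)) (r * exp (detour_V R i)))" for R
  proof -
    define K where "K = exp (real R)"
    have K: "1 \<le> K" "ln K = real R" unfolding K_def by auto
    \<comment> \<open>On the second side \<open>V\<close> is at most \<open>r * K\<^sup>2\<close>,
      so with this slope defect its term is at most \<open>A' * (r / K)\<close>, the size of the
      term in \<open>U\<close>.\<close>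
    define m where "m = 1 / K ^ 3"
    have m: "0 < m" "m \<le> 1" unfolding m_def using K by (auto simp: field_simps)
    obtain \<zeta> g where s2: "\<And>z. z \<in> \<Omega> \<Longrightarrow> 0 < half_space_fun \<zeta> g z" "1 - 2 * (m / 2) \<le> \<zeta> \<bullet> u" "\<zeta> \<bullet> u \<le> 1"
      using plane_half_space_almost_lightlike[OF u asym[of "m / 2"]] m by auto
    define A' B' where "A' = (1 + \<zeta> \<bullet> u) / 2" and "B' = (1 - \<zeta> \<bullet> u) / 2"
    have AB': "0 < A'" "0 \<le> B'" "B' \<le> m * A'"
    proof -
      have 1: "B' \<le> m / 2" "1 / 2 \<le> A'" unfolding A'_def B'_def using s2 m by (auto simp: field_simps)
      then show "0 < A'" "0 \<le> B'" using s2 unfolding B'_def by auto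
      have "m * (1 / 2) \<le> m * A'" using 1 m by (intro mult_left_mono) auto
      then show "B' \<le> m * A'" using 1 by simp
    qed
    define c' where "c' = half_space_fun \<zeta> g (plane_pt u 0 0)"
    have c': "0 < c'" unfolding c'_def using s2(1) plane_pt_mem[OF u] by simp
    have h2: "half_space_fun \<zeta> g (plane_pt u U V) = c' + A' * U + B' * V" for U V
      unfolding c'_def A'_def B'_def by (rule half_space_plane_pt)
    \<comment> \<open>The scale makes the constant terms \<open>c\<close> and \<open>c'\<close> of
      both functionals no larger than the terms in null coordinates they are compared with.\<close>
    define r where "r = max c (c' * K / A')"
    have r: "0 < r" "c \<le> r" unfolding r_def using c by auto
    have "c' * K / A' \<le> r" unfolding r_def by simp
    then have r': "c' \<le> A' * (r / K)" using AB' K by (simp add: field_simps)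
    define w where "w = plane_pt u r (r * K)"
    have rK: "r \<le> r * K" using r K by simp
    have far: "real R - C \<le> \<delta> w (plane_pt u (r * exp (detour_U R i)) (r * exp (detour_V R i)))" if i: "i \<le> 4 * R" for i
    proof -
      have i': "real i \<le> 4 * real R" using i by (metis of_nat_le_iff of_nat_mult of_nat_numeral)
      consider "i \<le> R" | "R \<le> i" "i \<le> 3 * R" | "3 * R \<le> i" by linarith
      then show ?thesis
      proof cases
        case 1
        then have U: "detour_U R i \<le> 0" and V: "detour_V R i = 0" using i' unfolding detour_U_def detour_V_def by auto
        define U' where "U' = r * exp (detour_U R i)"
        have U': "0 \<le> U'" "U' \<le> r" unfolding U'_def using U r by (auto simp: mult_left_le)
        have "c + A * U' + B * r \<le> 2 * r"
        proof -
          have "A * U' + B * r \<le> A * r + B * r" using U' AB by (simp add: mult_left_mono)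
          also have "\<dots> = r" using AB(3) by (metis distrib_right mult_1)
          finally show ?thesis using r by linarith
        qed
        then have "(B * K / 2) * (c + A * U' + B * r) \<le> (B * K / 2) * (2 * r)"
          using AB K by (intro mult_left_mono) auto
        also have "\<dots> \<le> c + A * r + B * (r * K)" using c AB r by simp
        finally have "ln (B * K / 2) \<le> \<delta> (plane_pt u U' r) w"
          unfolding w_def by (intro dist_plane_pt_ge[OF u _ _ _ _ s1(1)]) (use U' r K AB in \<open>auto simp: h1\<close>)
        moreover have "ln (B * K / 2) = ln (B / 2) + R" using AB K ln_mult_pos[of "B / 2" K] by simp
        ultimately have "real R - C \<le> \<delta> w (plane_pt u U' r)"
          unfolding C_def markowitz_dist_commute[of \<Omega> w] using ln3 by linarith
        then show ?thesis unfolding U'_def V by simp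
      next
        case 2
        then have U: "detour_U R i = - real R" and V: "detour_V R i \<le> 2 * real R"
          using i' unfolding detour_U_def detour_V_def by (auto simp: min_def max_def)
        define V' where "V' = r * exp (detour_V R i)"
        have "exp (detour_V R i) \<le> exp (real R + real R)" using V by simp
        then have V': "0 \<le> V'" "V' \<le> r * K\<^sup>2"
          unfolding V'_def K_def exp_add power2_eq_square using r by (auto intro: mult_left_mono)
        have "B' * V' \<le> (m * A') * (r * K\<^sup>2)" using V' AB' m r by (intro mult_mono) auto
        also have "\<dots> = A' * (r / K)" unfolding m_def using K by (simp add: power2_eq_square power3_eq_cube)
        finally have "c' + A' * (r / K) + B' * V' \<le> 3 * (A' * (r / K))" using r' by linarith
        then have "(K / 3) * (c' + A' * (r / K) + B' * V') \<le> (K / 3) * (3 * (A' * (r / K)))"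
          using K by (intro mult_left_mono) auto
        also have "\<dots> = A' * r" using K by simp
        also have "\<dots> \<le> c' + A' * r + B' * (r * K)" using c' AB' r K by simp
        finally have "ln (K / 3) \<le> \<delta> (plane_pt u (r / K) V') w"
          unfolding w_def by (intro dist_plane_pt_ge[OF u _ _ _ _ s2(1)]) (use V' r K in \<open>auto simp: h2\<close>)
        moreover have "ln (K / 3) = R - ln 3" using K by (simp add: ln_divide_pos)
        moreover have "r * exp (detour_U R i) = r / K" unfolding U K_def by (simp add: exp_minus divide_inverse)
        ultimately show ?thesis
          unfolding C_def V'_def using lnB markowitz_dist_commute[of \<Omega> w] by simp
      next
        case 3
        then have "3 * real R \<le> real i" by (metis of_nat_le_iff of_nat_mult of_nat_numeral)
        then have U: "detour_U R i \<le> 0" and V: "detour_V R i = real R + real R"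
          using i' unfolding detour_U_def detour_V_def by (auto simp: min_def max_def)
        define U' where "U' = r * exp (detour_U R i)"
        have U': "0 \<le> U'" unfolding U'_def using r by simp
        have "c + A * r + B * (r * K) \<le> 2 * (r * K)"
        proof -
          have "A * r + B * (r * K) \<le> A * (r * K) + B * (r * K)" using rK AB by (simp add: mult_left_mono)
          also have "\<dots> = r * K" using AB(3) by (metis distrib_right mult_1)
          finally show ?thesis using r rK by linarith
        qed
        then have "(B * K / 2) * (c + A * r + B * (r * K)) \<le> (B * K / 2) * (2 * (r * K))"
          using AB K by (intro mult_left_mono) auto
        also have "\<dots> \<le> c + A * U' + B * (r * (K * K))" using c AB U' by (simp add: add_nonneg_nonneg)
        finally have "ln (B * K / 2) \<le> \<delta> w (plane_pt u U' (r * (K * K)))"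
          unfolding w_def by (intro dist_plane_pt_ge[OF u _ _ _ _ s1(1)]) (use U' r K AB in \<open>auto simp: h1\<close>)
        moreover have "ln (B * K / 2) = ln (B / 2) + R" using AB K ln_mult_pos[of "B / 2" K] by simp
        ultimately have "real R - C \<le> \<delta> w (plane_pt u U' (r * (K * K)))"
          unfolding C_def using ln3 by linarith
        then show ?thesis unfolding U'_def V K_def exp_add .
      qed
    qed
    then show ?thesis using r(1) unfolding w_def K_def by blast
  qed
  then show ?thesis by (rule that)
qed

lemma detour_step:
  "\<bar>detour_U R i - detour_U R (Suc i)\<bar> \<le> 1" "\<bar>detour_V R i - detour_V R (Suc i)\<bar> \<le> 1"
  unfolding detour_U_def detour_V_def by (auto simp: min_def max_def abs_if)

lemma log_beaten_by_power:
  fixes a b :: real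
  obtains k :: nat where "a * real k + b < 2 ^ k"
proof -
  \<comment> \<open>With exponent \<open>2 * j\<close> the affine expression is at most
    \<open>j * j\<close>, to be compared factor by factor with \<open>2 ^ j * 2 ^ j\<close>.\<close>
  obtain j :: nat where j: "2 * \<bar>a\<bar> + \<bar>b\<bar> < real j" using reals_Archimedean2 by blast
  have "a * real (2 * j) + b \<le> 2 * \<bar>a\<bar> * real j + \<bar>b\<bar> * 1"
    using mult_right_mono[OF abs_ge_self[of a], of "2 * real j"] by simp
  also have "\<dots> \<le> 2 * \<bar>a\<bar> * real j + \<bar>b\<bar> * real j"
  proof (cases "j = 0")
    case False
    then show ?thesis by (intro add_left_mono mult_left_mono) auto
  qed (use j in simp)
  also have "\<dots> = (2 * \<bar>a\<bar> + \<bar>b\<bar>) * real j" by (simp add: algebra_simps)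
  also have "\<dots> \<le> real j * real j" using j by (intro mult_right_mono) auto
  also have "\<dots> < 2 ^ j * 2 ^ j"
    using of_nat_less_two_power[of j, where 'a = real] by (intro mult_strict_mono) auto
  also have "\<dots> = 2 ^ (2 * j)" by (simp add: mult_2 power_add)
  finally show ?thesis by (rule that)
qed

text \<open>The point \<open>w\<close> lies on a null geodesic whose ends are joined by a detour of
  \<open>4 * R\<close> steps of length at most 2. Thin triangles bring the detour within logarithmic
  distance in \<open>R\<close> of \<open>w\<close>, while \<open>detour_far\<close> keeps it at
  distance \<open>R - C\<close>.\<close>

lemma asymptotically_lightlike_not_hyperbolic:
  assumes u: "norm u = 1"
    and leaves: "\<And>x. x \<in> \<Omega> \<Longrightarrow> \<exists>s. x + s *\<^sub>R (1, u) \<notin> \<Omega>"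
    and asym: "\<And>e. 0 < e \<Longrightarrow> \<exists>C. \<forall>s\<ge>0. (1 - e) * s - C \<le> f (s *\<^sub>R u)"
  shows "\<not> gromov_hyperbolic \<Omega> \<delta>"
proof
  assume hyp: "gromov_hyperbolic \<Omega> \<delta>"
  interpret Metric_space \<Omega> \<delta> using hyp unfolding gromov_hyperbolic_def proper_metric_space_def by blast
  obtain \<rho> where thin: "\<And>x y z S T U p. \<lbrakk>geodesic_segment \<Omega> \<delta> x y S; geodesic_segment \<Omega> \<delta> y z T;
        geodesic_segment \<Omega> \<delta> z x U; p \<in> S\<rbrakk> \<Longrightarrow> \<exists>q\<in>T \<union> U. \<delta> p q \<le> \<rho>"
  proof -
    obtain r where r: "\<forall>x\<in>\<Omega>. \<forall>y\<in>\<Omega>. \<forall>z\<in>\<Omega>. \<forall>S T U.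
        geodesic_segment \<Omega> \<delta> x y S \<and> geodesic_segment \<Omega> \<delta> y z T \<and> geodesic_segment \<Omega> \<delta> z x U \<longrightarrow>
          S \<subseteq> nbhd \<Omega> \<delta> r (T \<union> U) \<and> T \<subseteq> nbhd \<Omega> \<delta> r (U \<union> S) \<and> U \<subseteq> nbhd \<Omega> \<delta> r (S \<union> T)"
      using hyp unfolding gromov_hyperbolic_def by blast
    have "\<exists>q\<in>T \<union> U. \<delta> p q \<le> r" if seg: "geodesic_segment \<Omega> \<delta> x y S" "geodesic_segment \<Omega> \<delta> y z T"
        "geodesic_segment \<Omega> \<delta> z x U" "p \<in> S" for x y z S T U p
    proof -
      have "p \<in> nbhd \<Omega> \<delta> r (T \<union> U)"
        using r geodesic_segment_ends(3,4)[OF seg(1)] geodesic_segment_ends(4)[OF seg(2)] seg by blast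
      then show ?thesis unfolding nbhd_def by force
    qed
    then show ?thesis by (rule that)
  qed
  obtain C where C: "\<And>R. \<exists>r>0. \<forall>i\<le>4 * R.
      real R - C \<le> \<delta> (plane_pt u r (r * exp R)) (plane_pt u (r * exp (detour_U R i)) (r * exp (detour_V R i)))"
    using detour_far[OF u leaves asym] plane_pt_mem[OF u, of 0 0] by auto
  \<comment> \<open>Since \<open>R = 2 ^ k\<close>, there are \<open>2 ^ (k + 2)\<close> steps; the
    condition reads \<open>\<rho> * (k + 2) + 2 < R - C\<close>.\<close>
  obtain k :: nat where k: "\<rho> * real k + (2 * \<rho> + 2 + C) < 2 ^ k" by (rule log_beaten_by_power)
  define R :: nat where "R = 2 ^ k"
  have RR: "4 * R = 2 ^ (k + 2)" unfolding R_def by (simp add: power_add)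
  obtain r where r: "0 < r" and far: "\<And>i. i \<le> 4 * R \<Longrightarrow>
      real R - C \<le> \<delta> (plane_pt u r (r * exp R)) (plane_pt u (r * exp (detour_U R i)) (r * exp (detour_V R i)))"
    using C[of R] by blast
  define x where "x i = plane_pt u (r * exp (detour_U R i)) (r * exp (detour_V R i))" for i
  define w where "w = plane_pt u r (r * exp (real R))"
  have xM: "x i \<in> \<Omega>" for i unfolding x_def by (rule plane_pt_mem[OF u]) (use r in auto)
  have w: "w \<in> \<Omega>" unfolding w_def by (rule plane_pt_mem[OF u]) (use r in auto)
  have step: "\<delta> (x i) (x (Suc i)) \<le> 2" for i
  proof -
    have "\<delta> (x i) (x (Suc i)) \<le> \<bar>ln (r * exp (detour_U R i)) - ln (r * exp (detour_U R (Suc i)))\<bar>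
        + \<bar>ln (r * exp (detour_V R i)) - ln (r * exp (detour_V R (Suc i)))\<bar>"
      unfolding x_def by (rule dist_plane_pt_le[OF u]) (use r in auto)
    also have "\<dots> = \<bar>detour_U R i - detour_U R (Suc i)\<bar> + \<bar>detour_V R i - detour_V R (Suc i)\<bar>"
      using r by (simp add: ln_mult_pos)
    also have "\<dots> \<le> 2" using detour_step[of R i] by linarith
    finally show ?thesis .
  qed
  have end0: "x 0 = plane_pt u r r" unfolding x_def detour_U_def detour_V_def by simp
  have end1: "x (4 * R) = plane_pt u r (r * exp (2 * real R))" unfolding x_def detour_U_def detour_V_def by simp
  have shift: "plane_pt u r V + s *\<^sub>R (1, u) = plane_pt u r (V + 2 * s)" for V s
    unfolding plane_pt_def by (simp add: field_simps scaleR_add_left[symmetric])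
  \<comment> \<open>Along \<open>(1, u)\<close> the coordinate \<open>V\<close> grows at twice the
    parameter, hence the halves.\<close>
  define a c where "a = (r * exp (real R) - r) / 2" and "c = (r * exp (2 * real R) - r * exp (real R)) / 2"
  have ac: "0 \<le> a" "0 \<le> c" unfolding a_def c_def using r by auto
  have "w - a *\<^sub>R (1, u) = w + (- a) *\<^sub>R (1, u)" by simp
  also have "\<dots> = x 0" unfolding w_def shift end0 a_def by (rule arg_cong) (simp add: field_simps)
  finally have "w - a *\<^sub>R (1, u) = x 0" .
  moreover have "w + c *\<^sub>R (1, u) = x (4 * R)"
    unfolding w_def shift end1 c_def by (rule arg_cong) (simp add: field_simps)
  ultimately obtain S where S: "w \<in> S" "geodesic_segment \<Omega> \<delta> (x 0) (x (4 * R)) S"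
    using null_line_geodesic[OF w u leaves[OF w], of a c] ac xM by auto
  have geo: "geodesic_metric_space \<Omega> \<delta>" using hyp unfolding gromov_hyperbolic_def by blast
  have "\<exists>i\<le>2 ^ (k + 2). \<delta> w (x i) \<le> \<rho> * real (k + 2) + 2"
  proof (rule thin_triangles_log_chain[OF geo])
    show "geodesic_segment \<Omega> \<delta> (x 0) (x (2 ^ (k + 2))) S" using S(2) unfolding RR .
  qed (fact thin, (rule xM step S(1))+)
  then obtain i where i: "i \<le> 2 ^ (k + 2)" "\<delta> w (x i) \<le> \<rho> * real (k + 2) + 2" by blast
  have "real R - C \<le> \<delta> w (x i)" using far[of i] i unfolding RR w_def x_def by simp
  then show False using i(2) k unfolding R_def by (simp add: algebra_simps)
qed

end

section \<open>Causality\<close>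

lemma future_causal_mink_eps_iff:
  assumes "0 \<le> e"
  shows "future_causal (mink_eps e) v \<longleftrightarrow> 0 < fst v \<and> norm (snd v) \<le> (1 + e) * fst v"
proof -
  have e: "0 < (1 + e)\<^sup>2" using assms by simp
  have "mink_eps e v (1, 0) = - ((1 + e)\<^sup>2 * fst v)" unfolding mink_eps_def by simp
  then have 1: "mink_eps e v (1, 0) < 0 \<longleftrightarrow> 0 < fst v" using e by (simp add: zero_less_mult_iff)
  have "mink_eps e v v = (norm (snd v))\<^sup>2 - ((1 + e) * fst v)\<^sup>2"
    unfolding mink_eps_def by (simp add: power2_norm_eq_inner power_mult_distrib power2_eq_square[of "fst v"])
  moreover have "(norm (snd v))\<^sup>2 \<le> ((1 + e) * fst v)\<^sup>2 \<longleftrightarrow> norm (snd v) \<le> (1 + e) * fst v" if "0 < fst v"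
    using assms that by (intro power_mono_iff) auto
  ultimately show ?thesis unfolding future_causal_def causal_def 1 by auto
qed

lemma future_causal_curve_line:
  assumes "future_causal B v"
  shows "future_causal_curve B 0 1 (\<lambda>t. x + t *\<^sub>R v)"
proof -
  define D where "D k = (if k = 0 then (\<lambda>t. x + t *\<^sub>R v) else if k = 1 then (\<lambda>_. v) else (\<lambda>_. 0))" for k :: nat
  have der: "(D k has_vector_derivative D (Suc k) t) (at t within {0..1})" for k t
    unfolding D_def by (auto intro!: derivative_eq_intros)
  have "smooth_future_causal_on B 0 1 (\<lambda>t. x + t *\<^sub>R v)"
    unfolding smooth_future_causal_on_def
    by (intro exI[of _ D] conjI ballI allI der) (use assms in \<open>auto simp: D_def\<close>)
  then show ?thesis
    unfolding future_causal_curve_def by (intro conjI exI[of _ "1::nat"] exI[of _ "\<lambda>i. real i"]) auto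
qed

text \<open>For \<open>w\<close> the direction of the spatial displacement,
  \<open>(1 + e) * t - w \<bullet> p\<close> is nondecreasing along the curve by Cauchy-Schwarz. For
  zero displacement \<open>w\<close> is 0.\<close>

lemma smooth_future_causal_displacement:
  assumes c: "smooth_future_causal_on (mink_eps e) a b c" and "a \<le> b" and e: "0 \<le> e"
  shows "norm (snd (c b) - snd (c a)) \<le> (1 + e) * (fst (c b) - fst (c a))"
proof -
  obtain D where D: "\<And>t. t \<in> {a..b} \<Longrightarrow> D 0 t = c t"
    "\<And>k t. t \<in> {a..b} \<Longrightarrow> (D k has_vector_derivative D (Suc k) t) (at t within {a..b})"
    "\<And>t. t \<in> {a..b} \<Longrightarrow> future_causal (mink_eps e) (D 1 t)"
    using c unfolding smooth_future_causal_on_def by blast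
  define w where "w = sgn (snd (c b) - snd (c a))"
  have w: "norm w \<le> 1" unfolding w_def by (simp add: norm_sgn)
  define g where "g t = (1 + e) * fst (D 0 t) - w \<bullet> snd (D 0 t)" for t
  have g': "(g has_vector_derivative (1 + e) * fst (D 1 t) - w \<bullet> snd (D 1 t)) (at t within {a..b})"
    if "t \<in> {a..b}" for t
  proof -
    have "bounded_linear (\<lambda>z :: 'a minkowski. (1 + e) * fst z - w \<bullet> snd z)"
      by (intro bounded_linear_intros)
    from bounded_linear.has_vector_derivative[OF this D(2)[OF that, of 0]] show ?thesis
      unfolding g_def by simp
  qed
  have "g a \<le> g b"
  proof (rule DERIV_nonneg_imp_increasing_open[OF \<open>a \<le> b\<close>])
    fix t assume t: "a < t" "t < b"
    have "(g has_real_derivative (1 + e) * fst (D 1 t) - w \<bullet> snd (D 1 t)) (at t)"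
      using g'[of t] t at_within_Icc_at[OF t] by (simp add: has_real_derivative_iff_has_vector_derivative)
    moreover have "w \<bullet> snd (D 1 t) \<le> 1 * norm (snd (D 1 t))"
      using norm_cauchy_schwarz[of w "snd (D 1 t)"] mult_right_mono[OF w norm_ge_zero[of "snd (D 1 t)"]] by linarith
    moreover have "norm (snd (D 1 t)) \<le> (1 + e) * fst (D 1 t)"
      using D(3)[of t] t unfolding future_causal_mink_eps_iff[OF e] by simp
    ultimately show "\<exists>y. (g has_real_derivative y) (at t) \<and> 0 \<le> y" by force
  next
    show "continuous_on {a..b} g"
      unfolding continuous_on_eq_continuous_within using has_vector_derivative_continuous[OF g'] by blast
  qed
  then have "w \<bullet> (snd (c b) - snd (c a)) \<le> (1 + e) * (fst (c b) - fst (c a))"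
    unfolding g_def using D(1)[of a] D(1)[of b] \<open>a \<le> b\<close> by (simp add: inner_diff_right algebra_simps)
  moreover have "w \<bullet> (snd (c b) - snd (c a)) = norm (snd (c b) - snd (c a))"
    unfolding w_def sgn_div_norm
    by (cases "snd (c b) = snd (c a)") (simp_all add: dot_square_norm power2_eq_square)
  ultimately show ?thesis by simp
qed

lemma future_causal_curve_displacement:
  assumes c: "future_causal_curve (mink_eps e) a b c" and e: "0 \<le> e"
  shows "norm (snd (c b) - snd (c a)) \<le> (1 + e) * (fst (c b) - fst (c a))"
proof -
  obtain m :: nat and \<tau> where t: "\<tau> 0 = a" "\<tau> m = b"
    "\<And>i. i < m \<Longrightarrow> \<tau> i < \<tau> (Suc i) \<and> smooth_future_causal_on (mink_eps e) (\<tau> i) (\<tau> (Suc i)) c"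
    using c unfolding future_causal_curve_def by blast
  have "norm (snd (c (\<tau> i)) - snd (c a)) \<le> (1 + e) * (fst (c (\<tau> i)) - fst (c a))" if "i \<le> m" for i
    using that
  proof (induction i)
    case 0
    then show ?case using t by simp
  next
    case (Suc i)
    have "norm (snd (c (\<tau> (Suc i))) - snd (c (\<tau> i))) \<le> (1 + e) * (fst (c (\<tau> (Suc i))) - fst (c (\<tau> i)))"
      using t(3)[of i] Suc.prems by (intro smooth_future_causal_displacement) (auto simp: e)
    moreover have "norm (snd (c (\<tau> (Suc i))) - snd (c a)) \<le>
        norm (snd (c (\<tau> (Suc i))) - snd (c (\<tau> i))) + norm (snd (c (\<tau> i)) - snd (c a))"
      using norm_triangle_ineq[of "snd (c (\<tau> (Suc i))) - snd (c (\<tau> i))" "snd (c (\<tau> i)) - snd (c a)"] by simp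
    ultimately show ?case using Suc by (simp add: algebra_simps)
  qed
  from this[of m] show ?thesis using t by simp
qed

text \<open>The displacement bound gives one direction; a straight segment is a causal curve for the
  other.\<close>

lemma causally_related_mink_eps_iff:
  assumes "x \<noteq> y" "0 \<le> e"
  shows "causally_related (mink_eps e) x y \<longleftrightarrow> norm (snd x - snd y) \<le> (1 + e) * \<bar>fst x - fst y\<bar>"
proof
  have mono: "(1 + e) * t \<le> (1 + e) * \<bar>t\<bar>" for t using assms(2) by (intro mult_left_mono) auto
  assume "causally_related (mink_eps e) x y"
  then obtain a b c where "future_causal_curve (mink_eps e) a b c" and xy: "c a = x \<and> c b = y \<or> c a = y \<and> c b = x"
    unfolding causally_related_def by blast
  then have "norm (snd (c b) - snd (c a)) \<le> (1 + e) * (fst (c b) - fst (c a))"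
    using future_causal_curve_displacement assms by blast
  also note mono
  finally show "norm (snd x - snd y) \<le> (1 + e) * \<bar>fst x - fst y\<bar>"
    using xy by (auto simp: norm_minus_commute abs_minus_commute)
next
  assume le: "norm (snd x - snd y) \<le> (1 + e) * \<bar>fst x - fst y\<bar>"
  have *: "\<exists>a b c. future_causal_curve (mink_eps e) a b c \<and> c a = x \<and> c b = y"
    if "fst x < fst y" "norm (snd x - snd y) \<le> (1 + e) * (fst y - fst x)" for x y :: "'a minkowski"
  proof -
    have "future_causal (mink_eps e) (y - x)"
      unfolding future_causal_mink_eps_iff[OF assms(2)] using that by (simp add: norm_minus_commute)
    from future_causal_curve_line[OF this, of x] show ?thesis
      by (intro exI[of _ 0] exI[of _ 1] exI[of _ "\<lambda>t. x + t *\<^sub>R (y - x)"]) simp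
  qed
  have "fst x \<noteq> fst y" using le assms(1) by (auto simp: prod_eq_iff)
  then consider "fst x < fst y" | "fst y < fst x" by linarith
  then show "causally_related (mink_eps e) x y"
  proof cases
    case 1
    then have "norm (snd x - snd y) \<le> (1 + e) * (fst y - fst x)" using le by simp
    from *[OF 1 this] show ?thesis unfolding causally_related_def by blast
  next
    case 2
    then have "norm (snd y - snd x) \<le> (1 + e) * (fst x - fst y)" using le by (simp add: norm_minus_commute)
    from *[OF 2 this] show ?thesis unfolding causally_related_def by blast
  qed
qed

section \<open>The boundary as a graph, and the proof of the equivalence\<close>

lemma (in epigraph_domain) frontier_eq: "frontier \<Omega> = {x. fst x = f (snd x)}"
proof -
  have cont: "continuous_on UNIV (\<lambda>x :: 'n minkowski. f (snd x))" "continuous_on UNIV (fst :: 'n minkowski \<Rightarrow> real)"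
    by (rule continuous_on_compose2[OF continuous_f]) (auto intro: continuous_intros)
  have op: "open \<Omega>" unfolding epi by (rule open_Collect_less[OF cont])
  have "closed {x. f (snd x) \<le> fst x}" by (rule closed_Collect_le[OF cont])
  then have "closure \<Omega> \<subseteq> {x. f (snd x) \<le> fst x}" unfolding epi by (intro closure_minimal) auto
  moreover have "x \<in> closure \<Omega>" if "fst x = f (snd x)" for x
  proof (rule Lim_in_closed_set[OF closed_closure _ trivial_limit_sequentially])
    have "(\<lambda>n. (fst x + inverse (real (Suc n)), snd x)) \<longlonglongrightarrow> (fst x + 0, snd x)"
      by (intro tendsto_intros LIMSEQ_inverse_real_of_nat)
    then show "(\<lambda>n. (fst x + inverse (real (Suc n)), snd x)) \<longlonglongrightarrow> x" by simp
    have "(fst x + inverse (real (Suc n)), snd x) \<in> \<Omega>" for n unfolding epi using that by simp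
    then show "\<forall>\<^sub>F n in sequentially. (fst x + inverse (real (Suc n)), snd x) \<in> closure \<Omega>"
      using closure_subset by (intro always_eventually) blast
  qed
  ultimately show ?thesis unfolding frontier_def interior_open[OF op] by (auto simp: epi)
qed

text \<open>Distinct points of the graph are unrelated for \<open>mink_eps e\<close> exactly if
  \<open>(1 + e) * \<bar>f p - f q\<bar> < norm (p - q)\<close>.\<close>

lemma (in epigraph_domain) stably_acausal_frontier_iff:
  "stably_acausal (frontier \<Omega>) \<longleftrightarrow> (\<exists>L. 0 \<le> L \<and> L < 1 \<and> (\<forall>p q. \<bar>f p - f q\<bar> \<le> L * norm (p - q)))"
proof
  assume "stably_acausal (frontier \<Omega>)"
  then obtain e where e: "0 < e" "eps_stably_acausal e (frontier \<Omega>)" unfolding stably_acausal_def by blast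
  have "\<bar>f p - f q\<bar> \<le> 1 / (1 + e) * norm (p - q)" for p q
  proof (cases "p = q")
    case False
    then have "\<not> causally_related (mink_eps e) (f p, p) (f q, q)"
      using e(2) unfolding eps_stably_acausal_def frontier_eq by simp
    then have "(1 + e) * \<bar>f p - f q\<bar> < norm (p - q)"
      using causally_related_mink_eps_iff[of "(f p, p)" "(f q, q)" e] False e(1) by (simp add: not_le)
    then show ?thesis using e(1) by (simp add: field_simps)
  qed simp
  moreover have "0 \<le> 1 / (1 + e)" "1 / (1 + e) < 1" using e(1) by auto
  ultimately show "\<exists>L. 0 \<le> L \<and> L < 1 \<and> (\<forall>p q. \<bar>f p - f q\<bar> \<le> L * norm (p - q))" by blast
next
  assume "\<exists>L. 0 \<le> L \<and> L < 1 \<and> (\<forall>p q. \<bar>f p - f q\<bar> \<le> L * norm (p - q))"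
  then obtain L where L: "0 \<le> L" "L < 1" "\<And>p q. \<bar>f p - f q\<bar> \<le> L * norm (p - q)" by blast
  \<comment> \<open>Any \<open>e > 0\<close> with \<open>(1 + e) * L < 1\<close> would do.\<close>
  define e where "e = (1 - L) / 2"
  have e: "0 < e" using L e_def by simp
  have "L * ((1 - L) / 2) < 1 * (1 - L)" using L by (intro mult_less_le_imp_less) auto
  then have eL: "(1 + e) * L < 1" unfolding e_def by (simp add: algebra_simps)
  have "\<not> causally_related (mink_eps e) x y" if xy: "fst x = f (snd x)" "fst y = f (snd y)" "x \<noteq> y" for x y
  proof
    assume "causally_related (mink_eps e) x y"
    then have "norm (snd x - snd y) \<le> (1 + e) * \<bar>fst x - fst y\<bar>"
      using causally_related_mink_eps_iff[OF xy(3)] e by simp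
    also have "\<dots> \<le> (1 + e) * (L * norm (snd x - snd y))"
      using L(3)[of "snd x" "snd y"] e xy by (intro mult_left_mono) auto
    also have "\<dots> < 1 * norm (snd x - snd y)"
      unfolding mult.assoc[symmetric] using eL xy by (intro mult_strict_right_mono) (auto simp: prod_eq_iff)
    finally show False by simp
  qed
  then show "stably_acausal (frontier \<Omega>)"
    unfolding stably_acausal_def eps_stably_acausal_def frontier_eq using e by blast
qed

text \<open>Future completeness makes the boundary function 1-Lipschitz, and supporting hyperplanes of
  \<open>\<Omega>\<close> give its subgradients.\<close>

lemma convex_future_complete_epigraph:
  fixes \<Omega> :: "'n::finite minkowski set"
  assumes dom: "mink_domain \<Omega>" and conv: "convex \<Omega>" and fc: "future_complete \<Omega>"
  obtains f where "epigraph_domain f \<Omega>"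
proof -
  have up: "x + v \<in> \<Omega>" if x: "x \<in> \<Omega>" and v: "norm (snd v) \<le> fst v" for x v
  proof (cases "v = 0")
    case False
    then have "fst v \<noteq> 0" using v by (auto simp: prod_eq_iff)
    then have "0 < fst v" using order_trans[OF norm_ge_zero v] by simp
    then have "future_causal mink v" using v future_causal_mink_eps_iff[of 0 v] by simp
    from future_causal_curve_line[OF this, of x]
    have "(\<lambda>t. x + t *\<^sub>R v) ` {0..1} \<subseteq> \<Omega>"
      using fc x unfolding future_complete_def by (metis (no_types, lifting) add.right_neutral scaleR_zero_left)
    then have "x + 1 *\<^sub>R v \<in> \<Omega>" by (metis atLeastAtMost_iff image_subset_iff order_refl zero_le_one)
    then show ?thesis by simp
  qed (use x in simp)
  obtain z where z: "z \<notin> \<Omega>" using dom unfolding mink_domain_def by blast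
  obtain o' where o: "o' \<in> \<Omega>" using dom unfolding mink_domain_def by blast
  have op: "open \<Omega>" using dom unfolding mink_domain_def by blast
  define A where "A p = {t. (t, p) \<in> \<Omega>}" for p
  define f where "f p = Inf (A p)" for p
  \<comment> \<open>A lower point over \<open>p\<close> would have the missing point
    \<open>z\<close> in its future.\<close>
  have lower: "fst z - norm (snd z - p) \<le> t" if "t \<in> A p" for t p
  proof (rule ccontr)
    assume "\<not> ?thesis"
    then have "(t, p) + (z - (t, p)) \<in> \<Omega>" by (intro up) (use that A_def in auto)
    then show False using z by simp
  qed
  have bdd: "bdd_below (A p)" for p using lower by (rule bdd_belowI)
  have ne: "A p \<noteq> {}" for p
    using up[OF o, of "(norm (p - snd o'), p - snd o')"] unfolding A_def by (auto simp: plus_prod_def)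
  have mem: "(t, p) \<in> \<Omega> \<longleftrightarrow> f p < t" for t p
  proof
    assume t: "(t, p) \<in> \<Omega>"
    \<comment> \<open>Openness prevents the infimum from being attained, so the epigraph is
      strict.\<close>
    have "open (A p)"
      unfolding A_def using open_vimage[OF op, of "\<lambda>t. (t, p)"] by (simp add: vimage_def continuous_intros)
    then obtain d where d: "0 < d" "ball t d \<subseteq> A p" using t unfolding A_def open_contains_ball by blast
    then have "t - d / 2 \<in> A p" by (intro subsetD[OF d(2)]) (simp add: dist_real_def)
    then have "f p \<le> t - d / 2" unfolding f_def by (rule cInf_lower[OF _ bdd])
    then show "f p < t" using d(1) by simp
  next
    assume "f p < t"
    then obtain s where "s \<in> A p" "s < t" using cInf_lessD[OF ne] unfolding f_def by blast
    then show "(t, p) \<in> \<Omega>" using up[of "(s, p)" "(t - s, 0)"] unfolding A_def by simp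
  qed
  have lip1: "f q \<le> f p + norm (p - q)" for p q
  proof (rule field_le_epsilon)
    fix d :: real assume "0 < d"
    then have "(f p + d, p) \<in> \<Omega>" using mem by simp
    from up[OF this, of "(norm (p - q), q - p)"] have "(f p + d + norm (p - q), q) \<in> \<Omega>"
      by (simp add: norm_minus_commute)
    then show "f q \<le> f p + norm (p - q) + d" using mem by (simp add: less_imp_le algebra_simps)
  qed
  have subgrad: "\<exists>\<xi>. \<forall>q. f p + \<xi> \<bullet> (q - p) \<le> f q" for p
  proof -
    have "{(f p, p)} \<inter> \<Omega> = {}" using mem by auto
    moreover have "\<Omega> \<noteq> {}" using o by blast
    ultimately have "\<exists>a b. a \<noteq> 0 \<and> (\<forall>x\<in>{(f p, p)}. a \<bullet> x \<le> b) \<and> (\<forall>x\<in>\<Omega>. b \<le> a \<bullet> x)"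
      by (intro separating_hyperplane_sets conv) simp_all
    then obtain a b where a: "a \<noteq> 0" "a \<bullet> (f p, p) \<le> b" "\<And>x. x \<in> \<Omega> \<Longrightarrow> b \<le> a \<bullet> x" by blast
    obtain \<alpha> \<beta> where ab: "a = (\<alpha>, \<beta>)" by (cases a)
    have sep: "\<alpha> * f p + \<beta> \<bullet> p \<le> \<alpha> * t + \<beta> \<bullet> q" if "f q < t" for t q
      using a(2) a(3)[of "(t, q)"] that mem unfolding ab by (simp add: inner_prod_def)
    have "0 \<le> \<alpha>" using sep[of p "f p + 1"] by (simp add: distrib_left)
    \<comment> \<open>A vertical hyperplane cannot bound \<open>\<Omega>\<close>, which projects
      onto all of space; dividing by \<open>\<alpha>\<close> then gives a subgradient.\<close>
    moreover have "\<alpha> \<noteq> 0"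
    proof
      assume "\<alpha> = 0"
      then have "\<beta> \<bullet> \<beta> \<le> 0" using sep[of "p - \<beta>" "f (p - \<beta>) + 1"] by (simp add: inner_diff_right)
      then have "\<beta> = 0" using inner_ge_zero[of \<beta>] by (simp add: order_antisym)
      then show False using \<open>\<alpha> = 0\<close> a(1) ab by (simp add: zero_prod_def)
    qed
    ultimately have \<alpha>: "0 < \<alpha>" by simp
    have "f p + (- \<beta> /\<^sub>R \<alpha>) \<bullet> (q - p) \<le> f q" for q
    proof (rule field_le_epsilon)
      fix d :: real assume "0 < d"
      then have "\<alpha> * f p - \<beta> \<bullet> (q - p) \<le> \<alpha> * (f q + d)" using sep[of q "f q + d"] by (simp add: inner_diff_right)
      then show "f p + (- \<beta> /\<^sub>R \<alpha>) \<bullet> (q - p) \<le> f q + d" using \<alpha> by (simp add: field_simps)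
    qed
    then show ?thesis by blast
  qed
  have "epigraph_domain f \<Omega>"
  proof
    show "\<Omega> = {x. f (snd x) < fst x}" using mem by (metis (no_types, lifting) Collect_cong Collect_mem_eq prod.collapse)
    show "\<bar>f p - f q\<bar> \<le> norm (p - q)" for p q
      using lip1[of p q] lip1[of q p] by (simp add: abs_le_iff norm_minus_commute)
    show "\<exists>\<xi>. \<forall>q. f p + \<xi> \<bullet> (q - p) \<le> f q" for p by (rule subgrad)
  qed
  then show ?thesis by (rule that)
qed

theorem theoremB:
  fixes \<Omega> :: "'n::finite minkowski set"
  assumes "mink_domain \<Omega>"
    and "convex \<Omega>"
    and "future_complete \<Omega>"
    and "\<And>L. lightlike_line L \<Longrightarrow> \<not> L \<subseteq> \<Omega>"
  shows "gromov_hyperbolic \<Omega> (markowitz_dist \<Omega>) \<longleftrightarrow> stably_acausal (frontier \<Omega>)"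
proof -
  obtain f where "epigraph_domain f \<Omega>"
    by (rule convex_future_complete_epigraph[OF assms(1-3)])
  then interpret epigraph_domain f \<Omega> .
  have leaves: "\<exists>s. x + s *\<^sub>R (1, u) \<notin> \<Omega>" if "norm u = 1" for x u
  proof -
    have "lightlike_line (range (\<lambda>s. x + s *\<^sub>R (1, u)))"
      unfolding lightlike_line_def using lightlike_unit[OF that] by blast
    then show ?thesis using assms(4) by blast
  qed
  show ?thesis
    unfolding stably_acausal_frontier_iff
  proof
    assume "\<exists>L. 0 \<le> L \<and> L < 1 \<and> (\<forall>p q. \<bar>f p - f q\<bar> \<le> L * norm (p - q))"
    then obtain L where "0 \<le> L" "L < 1" "\<And>p q. \<bar>f p - f q\<bar> \<le> L * norm (p - q)" by blast
    then interpret spacelike_epigraph f \<Omega> L by unfold_locales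
    show "gromov_hyperbolic \<Omega> (markowitz_dist \<Omega>)" by (rule gromov_hyperbolic_dist)
  next
    assume hyp: "gromov_hyperbolic \<Omega> (markowitz_dist \<Omega>)"
    show "\<exists>L. 0 \<le> L \<and> L < 1 \<and> (\<forall>p q. \<bar>f p - f q\<bar> \<le> L * norm (p - q))"
    proof (rule ccontr)
      assume neg: "\<not> ?thesis"
      have "\<exists>p q. L * norm (p - q) < \<bar>f p - f q\<bar>" if "0 \<le> L" "L < 1" for L
        using neg that by (meson not_le)
      then obtain u where "norm u = 1" "\<And>e. 0 < e \<Longrightarrow> \<exists>C. \<forall>s\<ge>0. (1 - e) * s - C \<le> f (s *\<^sub>R u)"
        using asymptotic_direction by metis
      then show False using asymptotically_lightlike_not_hyperbolic leaves hyp by metis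
    qed
  qed
qed

end
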